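(* For every $\alpha\in(1,2]$ there exists $n_0$ such that the following holds for all $n\ge n_0$ and $d\ge 2$. Consider an evolution, on the time interval $(-\infty,\infty)$, of $n$ hard balls $B_1,\dots,B_n$ in $\mathbb{R}^d$ of equal masses and radii $1$, colliding elastically, with no simultaneous collisions. If the total number of collisions is greater than or equal to $n^{n^\alpha}$, then there exist a family $\mathcal{B}=\{B_{i_1},\dots,B_{i_k}\}$ of balls and an interval $[t_1,t_2]$ such that $\mathcal{B}$ is $n^{-\frac13 n^\alpha}$-connected in $[t_1,t_2]$ and there are more than $n^{\frac13 n^\alpha}$ collisions among balls in $\mathcal{B}$ on $[t_1,t_2]$.
   Context: Hard ball dynamics: $n$ balls in $\mathbb{R}^d$ have radius $1$ and equal masses. The centers $x^k(t)$ are continuous functions of $t\in\mathbb{R}$ with $|x^j(t)-x^k(t)|\ge 2$ for $j\ne k$ (balls do not overlap), and velocities $v^k$ are constant between collisions. Balls $j$ and $k$ collide at time $t$ if $|x^j(t)-x^k(t)|=2$ and their velocities change at time $t$. In that case the velocities just before the collision satisfy $(v^j(t-)-v^k(t-))\cdot(x^j(t)-x^k(t))<0$ and, with $x^{jk}(t)=(x^j(t)-x^k(t))/|x^j(t)-x^k(t)|$, $$v^j(t+)=v^j(t-)+(v^k(t-)\cdot x^{jk}(t))x^{jk}(t)-(v^j(t-)\cdot x^{jk}(t))x^{jk}(t),$$ $$v^k(t+)=v^k(t-)+(v^j(t-)\cdot x^{jk}(t))x^{jk}(t)-(v^k(t-)\cdot x^{jk}(t))x^{jk}(t).$$ The velocity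 of a ball changes only at its collisions. No simultaneous collisions: there is no time $t$ and no collection of at least three balls such that any two balls of the collection are linked by a chain of balls in which consecutive balls are in contact at time $t$. (Two disjoint touching pairs at the same time are allowed.) Consequently there are only finitely many collisions in every finite time interval. $\rho$-connectedness: for $\rho>0$, $\Gamma_\rho(t)$ is the graph with vertices $B_1,\dots,B_n$ in which $B_j$ and $B_k$ are joined by an edge if and only if $|x^j(t)-x^k(t)|\le 2+\rho$. A subfamily $\{B_{i_1},\dots,B_{i_k}\}$ is $\rho$-connected in $[s,u]$ if for every $t\in[s,u]$ all the balls $B_{i_1},\dots,B_{i_k}$ belong to one connected component of $\Gamma_\rho(t)$ (the component may depend on $t$ and may contain other balls). A collision among balls in $\mathcal{B}$ is a collision between two balls both belonging to $\mathcal{B}$. *)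

theory Defs
  imports "HOL-Analysis.Analysis"
begin

text \<open>
  The threshold \<open>n0\<close> of the theorem must not depend on the dimension, so the dimension cannot be a
  type: points of $d$-dimensional space are the elements of \<^term>\<open>topspace (Euclidean_space d)\<close>,
  that is, functions of type \<^typ>\<open>nat \<Rightarrow> real\<close> vanishing at all indices \<open>\<ge> d\<close>.
  Balls are numbered by \<^term>\<open>{..<n::nat}\<close>, and \<open>x k t\<close> is the center of ball \<open>k\<close> at time \<open>t\<close>.
\<close>

type_synonym point = "nat \<Rightarrow> real"
type_synonym motion = "nat \<Rightarrow> real \<Rightarrow> point"

definition eucl_dist :: "nat \<Rightarrow> point \<Rightarrow> point \<Rightarrow> real" where
  "eucl_dist d p q = L2_set (\<lambda>i. p i - q i) {..<d}"

definition eucl_inner :: "nat \<Rightarrow> point \<Rightarrow> point \<Rightarrow> real" where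
  "eucl_inner d p q = (\<Sum>i<d. p i * q i)"

text \<open>
  The one-sided velocities \<open>v(t-)\<close> and \<open>v(t+)\<close>. They are meaningful only if the one-sided derivatives
  exist, which \<open>hard_ball_evolution\<close> below requires at every time.
\<close>

definition vel_before :: "motion \<Rightarrow> nat \<Rightarrow> real \<Rightarrow> point" where
  "vel_before x k t = (\<lambda>i. vector_derivative (\<lambda>s. x k s i) (at_left t))"

definition vel_after :: "motion \<Rightarrow> nat \<Rightarrow> real \<Rightarrow> point" where
  "vel_after x k t = (\<lambda>i. vector_derivative (\<lambda>s. x k s i) (at_right t))"

text \<open>Touching balls (of radius 1) whose velocities do not change are not counted as colliding.\<close>

definition collide :: "nat \<Rightarrow> motion \<Rightarrow> real \<Rightarrow> nat \<Rightarrow> nat \<Rightarrow> bool" where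
  "collide d x t j k \<longleftrightarrow>
     eucl_dist d (x j t) (x k t) = 2 \<and>
     vel_before x j t \<noteq> vel_after x j t \<and> vel_before x k t \<noteq> vel_after x k t"

definition unit_dir :: "nat \<Rightarrow> motion \<Rightarrow> real \<Rightarrow> nat \<Rightarrow> nat \<Rightarrow> point" where
  "unit_dir d x t j k = (\<lambda>i. (x j t i - x k t i) / eucl_dist d (x j t) (x k t))"

locale hard_ball_evolution =
  fixes n d :: nat and x :: motion
  assumes continuous_centers:
      "\<And>k. k < n \<Longrightarrow> continuous_map euclideanreal (Euclidean_space d) (x k)"
    and no_overlap:
      "\<And>j k t. j < n \<Longrightarrow> k < n \<Longrightarrow> j \<noteq> k \<Longrightarrow> eucl_dist d (x j t) (x k t) \<ge> 2"
    and one_sided_velocities: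
      "\<And>k t i. k < n \<Longrightarrow> i < d \<Longrightarrow>
         (\<lambda>s. x k s i) differentiable (at_left t) \<and> (\<lambda>s. x k s i) differentiable (at_right t)"
    and velocity_constant_between_collisions:
      "\<And>k a b. k < n \<Longrightarrow> \<forall>t\<in>{a<..<b}. \<forall>l<n. \<not> collide d x t k l \<Longrightarrow>
         \<exists>v :: point. \<forall>t\<in>{a<..<b}. \<forall>i<d. ((\<lambda>s. x k s i) has_real_derivative v i) (at t)"
    and incoming:
      "\<And>j k t. j < n \<Longrightarrow> k < n \<Longrightarrow> collide d x t j k \<Longrightarrow>
         eucl_inner d (\<lambda>i. vel_before x j t i - vel_before x k t i) (\<lambda>i. x j t i - x k t i) < 0"
    and elastic:
      "\<And>j k t i. j < n \<Longrightarrow> k < n \<Longrightarrow> collide d x t j k \<Longrightarrow> i < d \<Longrightarrow>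
         vel_after x j t i = vel_before x j t i
           + eucl_inner d (vel_before x k t) (unit_dir d x t j k) * unit_dir d x t j k i
           - eucl_inner d (vel_before x j t) (unit_dir d x t j k) * unit_dir d x t j k i \<and>
         vel_after x k t i = vel_before x k t i
           + eucl_inner d (vel_before x j t) (unit_dir d x t j k) * unit_dir d x t j k i
           - eucl_inner d (vel_before x k t) (unit_dir d x t j k) * unit_dir d x t j k i"

definition contact :: "nat \<Rightarrow> nat \<Rightarrow> motion \<Rightarrow> real \<Rightarrow> (nat \<times> nat) set" where
  "contact n d x t = {(j, k). j < n \<and> k < n \<and> eucl_dist d (x j t) (x k t) = 2}"

definition no_simultaneous_collisions :: "nat \<Rightarrow> nat \<Rightarrow> motion \<Rightarrow> bool" where
  "no_simultaneous_collisions n d x \<longleftrightarrow>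
     \<not> (\<exists>t. \<exists>S \<subseteq> {..<n}. card S \<ge> 3 \<and> (\<forall>j\<in>S. \<forall>k\<in>S. (j, k) \<in> (contact n d x t)\<^sup>*))"

text \<open>A collision is an unordered pair of balls together with a time.\<close>

definition collisions :: "nat \<Rightarrow> motion \<Rightarrow> nat set \<Rightarrow> real set \<Rightarrow> (nat set \<times> real) set" where
  "collisions d x \<B> T =
     {({j, k}, t) | j k t. j \<in> \<B> \<and> k \<in> \<B> \<and> t \<in> T \<and> collide d x t j k}"

text \<open>The edge relation (symmetric) of the graph $\Gamma_\rho(t)$ on the vertex set \<^term>\<open>{..<n::nat}\<close>.\<close>

definition proximity :: "nat \<Rightarrow> nat \<Rightarrow> motion \<Rightarrow> real \<Rightarrow> real \<Rightarrow> (nat \<times> nat) set" where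
  "proximity n d x \<rho> t =
     {(j, k). j < n \<and> k < n \<and> j \<noteq> k \<and> eucl_dist d (x j t) (x k t) \<le> 2 + \<rho>}"

definition rho_connected :: "nat \<Rightarrow> nat \<Rightarrow> motion \<Rightarrow> real \<Rightarrow> nat set \<Rightarrow> real set \<Rightarrow> bool" where
  "rho_connected n d x \<rho> \<B> T \<longleftrightarrow>
     (\<forall>t\<in>T. \<forall>j\<in>\<B>. \<forall>k\<in>\<B>. (j, k) \<in> (proximity n d x \<rho> t)\<^sup>*)"

end

theory Submission
  imports Defs
begin

text \<open>
  For a family \<open>F\<close> of balls that does not collide with the rest, let \<open>y\<close> be the vector of all relative
  positions, \<open>I = |y|\<^sup>2\<close>, and let \<open>E\<close> be the sum of the squared relative velocities, which is
  conserved. Collisions only increase the slope of \<open>I\<close>, so \<open>I t - E t\<^sup>2\<close> is convex; together with the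
  Lipschitz bound \<open>|y t - y s| \<le> sqrt E |t - s|\<close> this gives
  \<open>|y s - l y t| \<le> (1 - l) |y t0|\<close> for \<open>s = t0 + l (t - t0)\<close>: far from the time \<open>t0\<close> of the minimum
  of \<open>I\<close>, the motion is a homothety up to a bounded error. Hence outside a window of length polynomial
  in \<open>n\<close> (in the time unit \<open>|y t0| / sqrt E\<close>) the family splits for good into two subfamilies on each
  side, and a recursion on the size of the family costs only a factor polynomial in \<open>n\<close> per level.
  When \<open>F\<close> is tight at \<open>t0\<close>, the window consists of \<open>O(n ^ 4 / \<rho>)\<close> pieces on which all distances vary
  by at most \<open>\<rho> / 2\<close>; on each piece only the components of a fixed \<open>\<rho>\<close>-connected graph collide.
  If every \<open>\<rho>\<close>-connected family has at most \<open>M\<close> collisions, there are therefore at most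
  \<open>n ^ O(n) M / \<rho>\<close> collisions in total. The exponents of \<open>M\<close> and \<open>1 / \<rho>\<close> add up to \<open>2/3 n powr \<alpha>\<close>, and
  \<open>n ^ O(n)\<close> is absorbed because \<open>\<alpha> > 1\<close>.
\<close>

subsection \<open>Convexity and combinatorial preliminaries\<close>

text \<open>The compact set where \<open>f t \<le> f a\<close> has a last point, and the local
  condition would push it further unless it is \<open>b\<close>. Only the right side of each time
  enters, since velocities jump at collisions.\<close>

lemma right_nonincreasing_imp_le:
  fixes f :: "real \<Rightarrow> real"
  assumes "a \<le> b" and cont: "continuous_on {a..b} f"
    and right: "\<And>t. a \<le> t \<Longrightarrow> t < b \<Longrightarrow> \<exists>\<epsilon>>0. \<forall>h. 0 < h \<and> h < \<epsilon> \<longrightarrow> f (t + h) \<le> f t"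
  shows "f b \<le> f a"
proof -
  define S where "S = {t \<in> {a..b}. f t \<le> f a}"
  have "closed S"
    unfolding S_def by (rule continuous_on_closed_Collect_le[OF cont continuous_on_const]) simp
  moreover have "S = S \<inter> {a..b}" by (auto simp: S_def)
  ultimately have "compact S"
    by (metis closed_Int_compact compact_Icc)
  moreover have "S \<noteq> {}"
    using \<open>a \<le> b\<close> by (auto simp: S_def)
  ultimately obtain p where p: "p \<in> S" "\<And>t. t \<in> S \<Longrightarrow> t \<le> p"
    by (meson compact_attains_sup)
  have "p = b"
  proof (rule ccontr)
    assume "p \<noteq> b"
    with p(1) have "a \<le> p" "p < b" by (auto simp: S_def)
    then obtain e where e: "e > 0" "\<And>h. 0 < h \<Longrightarrow> h < e \<Longrightarrow> f (p + h) \<le> f p"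
      using right by metis
    define h where "h = min (e / 2) (b - p)"
    have "0 < h" "h < e" "p + h \<le> b"
      using e(1) \<open>p < b\<close> by (auto simp: h_def min_def)
    then have "p + h \<in> S"
      using e(2)[of h] p(1) by (auto simp: S_def)
    with p(2) \<open>0 < h\<close> show False by force
  qed
  then show ?thesis using p(1) by (simp add: S_def)
qed

text \<open>The last point at which a positive maximum is attained violates the midpoint inequality.\<close>

lemma locally_midpoint_convex_nonpos:
  fixes u :: "real \<Rightarrow> real"
  assumes cont: "continuous_on {a..b} u" and ends: "u a \<le> 0" "u b \<le> 0"
    and mid: "\<And>t. a < t \<Longrightarrow> t < b \<Longrightarrow>
      \<exists>\<epsilon>>0. \<forall>h. 0 < h \<and> h < \<epsilon> \<longrightarrow> 2 * u t \<le> u (t - h) + u (t + h)"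
    and t: "t \<in> {a..b}"
  shows "u t \<le> 0"
proof (rule ccontr)
  assume pos: "\<not> u t \<le> 0"
  obtain m where m: "m \<in> {a..b}" "\<And>s. s \<in> {a..b} \<Longrightarrow> u s \<le> u m"
    using continuous_attains_sup[OF compact_Icc _ cont] t by blast
  define S where "S = {s \<in> {a..b}. u s = u m}"
  have "closedin (top_of_set {a..b}) S"
    unfolding S_def by (rule continuous_closedin_preimage_constant[OF cont])
  then have "compact S"
    using closedin_compact compact_Icc by blast
  moreover have "S \<noteq> {}"
    using m(1) by (auto simp: S_def)
  ultimately obtain p where p: "p \<in> S" "\<And>s. s \<in> S \<Longrightarrow> s \<le> p"
    by (meson compact_attains_sup)
  have "u m > 0" using pos m(2)[OF t] by linarith
  then have "a < p" "p < b"
    using p(1) ends by (auto simp: S_def order_less_le)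
  then obtain e where e: "e > 0" "\<And>h. 0 < h \<Longrightarrow> h < e \<Longrightarrow> 2 * u p \<le> u (p - h) + u (p + h)"
    using mid by metis
  define h where "h = min (e / 2) (min (b - p) (p - a))"
  have h: "0 < h" "h < e" "p + h \<le> b" "a \<le> p - h"
    using e(1) \<open>a < p\<close> \<open>p < b\<close> by (auto simp: h_def min_def)
  have "u (p - h) \<le> u m" "u (p + h) \<le> u m"
    using m(2) h by auto
  moreover have "u (p + h) \<noteq> u m"
    using p(2)[of "p + h"] h by (auto simp: S_def)
  moreover have "u p = u m" using p(1) by (simp add: S_def)
  ultimately show False using e(2)[OF h(1,2)] by linarith
qed

text \<open>Subtracting a chord preserves the local midpoint inequality and makes the endpoint
  values zero, so the previous lemma applies. The midpoint form suits a motion that is affine on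
  either side of each instant, possibly with different slopes.\<close>

lemma locally_midpoint_convex_imp_convex_on:
  fixes f :: "real \<Rightarrow> real"
  assumes cont: "continuous_on {a..b} f"
    and mid: "\<And>t. a < t \<Longrightarrow> t < b \<Longrightarrow>
      \<exists>\<epsilon>>0. \<forall>h. 0 < h \<and> h < \<epsilon> \<longrightarrow> 2 * f t \<le> f (t - h) + f (t + h)"
  shows "convex_on {a..b} f"
proof (rule convex_on_linorderI)
  fix l x y :: real
  assume l: "0 < l" "l < 1" and xy: "x \<in> {a..b}" "y \<in> {a..b}" "x < y"
  define c where "c = (f y - f x) / (y - x)"
  define u where "u t = f t - (f x + c * (t - x))" for t
  let ?t = "(1 - l) *\<^sub>R x + l *\<^sub>R y"
  have t: "?t = x + l * (y - x)" by (simp add: algebra_simps)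
  have "u ?t \<le> 0"
  proof (rule locally_midpoint_convex_nonpos[of x y u])
    show "continuous_on {x..y} u"
      unfolding u_def using xy by (intro continuous_intros continuous_on_subset[OF cont]) auto
    show "u x \<le> 0" "u y \<le> 0" using xy by (auto simp: u_def c_def)
    have "l * (y - x) \<le> 1 * (y - x)" "0 \<le> l * (y - x)"
      using l xy by (auto intro!: mult_right_mono)
    then show "?t \<in> {x..y}"
      unfolding t by auto
    fix r assume "x < r" "r < y"
    then obtain e where e: "e > 0" "\<forall>h. 0 < h \<and> h < e \<longrightarrow> 2 * f r \<le> f (r - h) + f (r + h)"
      using mid[of r] xy by auto
    then show "\<exists>e>0. \<forall>h. 0 < h \<and> h < e \<longrightarrow> 2 * u r \<le> u (r - h) + u (r + h)"
      by (intro exI[of _ e]) (auto simp: u_def algebra_simps)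
  qed
  moreover have "c * (?t - x) = l * (f y - f x)"
    using xy unfolding t c_def by simp
  ultimately show "f ?t \<le> (1 - l) * f x + l * f y"
    by (simp add: u_def algebra_simps)
qed simp

text \<open>
  Let \<open>I = |y|\<^sup>2\<close>. Expanding the square on the left and eliminating the scalar product of \<open>y s\<close> and
  \<open>y t\<close> by the Lipschitz bound leaves \<open>(1 - l) (I s - l I t + l (1 - l) E (t - t0)\<^sup>2)\<close>,
  to which strong convexity applies.
\<close>

lemma strongly_convex_norm_rescaling:
  fixes y :: "real \<Rightarrow> 'i \<Rightarrow> real" and E t0 t l :: real
  defines "s \<equiv> t0 + l * (t - t0)"
  assumes l: "0 \<le> l" "l \<le> 1"
    and lip: "(\<Sum>p\<in>P. (y t p - y s p)\<^sup>2) \<le> E * (t - s)\<^sup>2"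
    and conv: "(\<Sum>p\<in>P. (y s p)\<^sup>2) \<le>
      (1 - l) * (\<Sum>p\<in>P. (y t0 p)\<^sup>2) + l * (\<Sum>p\<in>P. (y t p)\<^sup>2) - E * l * (1 - l) * (t - t0)\<^sup>2"
  shows "(\<Sum>p\<in>P. (y s p - l * y t p)\<^sup>2) \<le> (1 - l)\<^sup>2 * (\<Sum>p\<in>P. (y t0 p)\<^sup>2)"
proof -
  let ?I = "\<lambda>r. \<Sum>p\<in>P. (y r p)\<^sup>2"
  have "(y s p - l * y t p)\<^sup>2 =
      (1 - l) * (y s p)\<^sup>2 - l * (1 - l) * (y t p)\<^sup>2 + l * (y t p - y s p)\<^sup>2" for p
    by (simp add: power2_eq_square algebra_simps)
  then have "(\<Sum>p\<in>P. (y s p - l * y t p)\<^sup>2) =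
      (1 - l) * ?I s - l * (1 - l) * ?I t + l * (\<Sum>p\<in>P. (y t p - y s p)\<^sup>2)"
    by (simp add: sum.distrib sum_subtractf sum_distrib_left)
  also have "\<dots> \<le> (1 - l) * ?I s - l * (1 - l) * ?I t + l * (E * (t - s)\<^sup>2)"
    using l lip by (intro add_left_mono mult_left_mono)
  also have "(t - s)\<^sup>2 = (1 - l)\<^sup>2 * (t - t0)\<^sup>2"
    unfolding s_def by (simp add: power2_eq_square algebra_simps)
  also have "(1 - l) * ?I s - l * (1 - l) * ?I t + l * (E * ((1 - l)\<^sup>2 * (t - t0)\<^sup>2)) =
      (1 - l) * (?I s - l * ?I t + E * l * (1 - l) * (t - t0)\<^sup>2)"
    by (simp add: power2_eq_square algebra_simps)
  also have "\<dots> \<le> (1 - l) * ((1 - l) * ?I t0)"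
    using l conv by (intro mult_left_mono) auto
  finally show ?thesis by (simp add: power2_eq_square algebra_simps)
qed

text \<open>
  Cut \<open>(0, r]\<close> into \<open>card F\<close> half-open intervals of equal length; since \<open>\<phi> j0 \<le> 0\<close>,
  one of them contains no value of \<open>\<phi>\<close>.
\<close>

lemma exists_gap:
  fixes \<phi> :: "'a \<Rightarrow> real"
  assumes fin: "finite F" and j0: "j0 \<in> F" "\<phi> j0 \<le> 0" and k0: "k0 \<in> F" "r < \<phi> k0" and "0 < r"
  shows "\<exists>A B. A \<union> B = F \<and> A \<inter> B = {} \<and> j0 \<in> A \<and> k0 \<in> B \<and>
    (\<forall>a\<in>A. \<forall>b\<in>B. r / card F \<le> \<phi> b - \<phi> a)"
proof -
  define m where "m = card F"
  have m: "m > 0" using fin j0 card_gt_0_iff unfolding m_def by blast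
  define h where "h j = \<lceil>\<phi> j * m / r\<rceil>" for j
  have "\<not> {1..int m} \<subseteq> h ` (F - {j0})"
  proof
    assume "{1..int m} \<subseteq> h ` (F - {j0})"
    then have "card {1..int m} \<le> card (F - {j0})"
      using fin by (meson card_image_le card_mono finite_Diff finite_imageI order_trans)
    then show False using m fin j0 by (simp add: m_def)
  qed
  then obtain i where "i \<in> {1..int m}" and i3: "i \<notin> h ` (F - {j0})" by blast
  then have i: "1 \<le> i" "i \<le> int m" by auto
  have hj0: "h j0 \<le> 0"
    using j0 m \<open>0 < r\<close> by (simp add: h_def divide_nonpos_pos mult_nonpos_nonneg)
  have "real m * r < \<phi> k0 * m" using k0(2) m by (simp add: mult.commute)
  then have "real m < \<phi> k0 * m / r" using \<open>0 < r\<close> by (simp add: field_simps)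
  then have hk0: "int m < h k0" unfolding h_def by linarith
  have ni: "h j \<noteq> i" if "j \<in> F" for j
    using that i i3 hj0 by (cases "j = j0") auto
  show ?thesis
  proof (intro exI conjI ballI)
    show "{j \<in> F. h j < i} \<union> {j \<in> F. i < h j} = F"
      using ni by (auto simp: neq_iff)
    show "{j \<in> F. h j < i} \<inter> {j \<in> F. i < h j} = {}" by auto
    show "j0 \<in> {j \<in> F. h j < i}" "k0 \<in> {j \<in> F. i < h j}"
      using j0 k0 hj0 hk0 i by auto
    fix a b assume ab: "a \<in> {j \<in> F. h j < i}" "b \<in> {j \<in> F. i < h j}"
    have "\<phi> a * m / r \<le> i - 1" "i < \<phi> b * m / r"
      using ab unfolding h_def by (simp_all, linarith+)
    then have "\<phi> a * m \<le> (i - 1) * r" "i * r < \<phi> b * m"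
      using \<open>0 < r\<close> by (simp_all add: field_simps)
    then have "r \<le> (\<phi> b - \<phi> a) * m" by (simp add: algebra_simps)
    then show "r / card F \<le> \<phi> b - \<phi> a"
      using m unfolding m_def[symmetric] by (simp add: field_simps)
  qed
qed

text \<open>Flattens all relative vectors of a family into one vector indexed by ordered pairs and
  coordinates, so that the norm and inner product of a single Euclidean space serve the whole
  family.\<close>

definition pairdiff :: "('a \<Rightarrow> 'b \<Rightarrow> real) \<Rightarrow> 'a \<times> 'a \<times> 'b \<Rightarrow> real" where
  "pairdiff V = (\<lambda>(j, k, i). V j i - V k i)"

text \<open>A polarized Lagrange identity: pair sums reduce to a sum over single balls and to the
  totals. Conservation of momentum and the laws of a single collision thereby carry over to relative
  quantities.\<close>

lemma sum_pairdiff_mult: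
  fixes X V :: "'a \<Rightarrow> 'b \<Rightarrow> real"
  shows "(\<Sum>p\<in>F \<times> F \<times> D. pairdiff X p * pairdiff V p) =
    2 * (card F * (\<Sum>j\<in>F. \<Sum>i\<in>D. X j i * V j i)) - 2 * (\<Sum>i\<in>D. (\<Sum>j\<in>F. X j i) * (\<Sum>j\<in>F. V j i))"
proof -
  have "(\<Sum>j\<in>F. \<Sum>k\<in>F. (X j i - X k i) * (V j i - V k i)) =
    2 * (card F * (\<Sum>j\<in>F. X j i * V j i)) - 2 * ((\<Sum>j\<in>F. X j i) * (\<Sum>j\<in>F. V j i))" for i
  proof -
    have "(\<Sum>j\<in>F. \<Sum>k\<in>F. (X j i - X k i) * (V j i - V k i)) =
      (\<Sum>j\<in>F. \<Sum>k\<in>F. X j i * V j i) + (\<Sum>j\<in>F. \<Sum>k\<in>F. X k i * V k i)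
        - (\<Sum>j\<in>F. \<Sum>k\<in>F. X j i * V k i) - (\<Sum>j\<in>F. \<Sum>k\<in>F. X k i * V j i)"
      by (simp add: algebra_simps sum.distrib sum_subtractf)
    moreover have "(\<Sum>j\<in>F. \<Sum>k\<in>F. X k i * V j i) = (\<Sum>j\<in>F. \<Sum>k\<in>F. X j i * V k i)"
      by (rule sum.swap)
    moreover have "(\<Sum>j\<in>F. \<Sum>k\<in>F. X j i * V k i) = (\<Sum>j\<in>F. X j i) * (\<Sum>j\<in>F. V j i)"
      by (simp add: sum_product)
    ultimately show ?thesis by (simp flip: sum_distrib_left)
  qed
  then have "(\<Sum>i\<in>D. \<Sum>j\<in>F. \<Sum>k\<in>F. (X j i - X k i) * (V j i - V k i)) =
    2 * (card F * (\<Sum>i\<in>D. \<Sum>j\<in>F. X j i * V j i)) - 2 * (\<Sum>i\<in>D. (\<Sum>j\<in>F. X j i) * (\<Sum>j\<in>F. V j i))"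
    by (simp add: sum_subtractf sum_distrib_left)
  moreover have "(\<Sum>p\<in>F \<times> F \<times> D. pairdiff X p * pairdiff V p) =
      (\<Sum>j\<in>F. \<Sum>k\<in>F. \<Sum>i\<in>D. (X j i - X k i) * (V j i - V k i))"
    by (simp add: sum.cartesian_product pairdiff_def case_prod_unfold)
  moreover have "\<dots> = (\<Sum>j\<in>F. \<Sum>i\<in>D. \<Sum>k\<in>F. (X j i - X k i) * (V j i - V k i))"
    by (intro sum.cong refl sum.swap)
  moreover have "\<dots> = (\<Sum>i\<in>D. \<Sum>j\<in>F. \<Sum>k\<in>F. (X j i - X k i) * (V j i - V k i))"
    by (rule sum.swap)
  moreover have "(\<Sum>i\<in>D. \<Sum>j\<in>F. X j i * V j i) = (\<Sum>j\<in>F. \<Sum>i\<in>D. X j i * V j i)"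
    by (rule sum.swap)
  ultimately show ?thesis by simp
qed

lemma subadditive_le_by_pieces:
  fixes N :: "real \<Rightarrow> real \<Rightarrow> real"
  assumes subadd: "\<And>s u w. s \<le> u \<Longrightarrow> u \<le> w \<Longrightarrow> N s w \<le> N s u + N u w"
    and piece: "\<And>s u. a \<le> s \<Longrightarrow> s \<le> u \<Longrightarrow> u \<le> b \<Longrightarrow> u - s \<le> \<delta> \<Longrightarrow> N s u \<le> X"
    and "a \<le> b" "0 < \<delta>" "0 \<le> X"
  shows "N a b \<le> ((b - a) / \<delta> + 1) * X"
proof -
  \<comment> \<open>Pieces of length \<open>\<delta>\<close> are peeled off from the left, the last
    one being cut short at \<open>b\<close>; with \<open>k\<close> the floor of the quotient,
    \<open>k + 1\<close> pieces suffice.\<close>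
  have *: "N s b \<le> (real k + 1) * X" if "a \<le> s" "s \<le> b" "b - s \<le> (real k + 1) * \<delta>" for s k
    using that
  proof (induction k arbitrary: s)
    case 0
    then show ?case using piece[of s b] by simp
  next
    case (Suc k)
    define u where "u = min b (s + \<delta>)"
    have u: "s \<le> u" "u \<le> b" "u - s \<le> \<delta>" "b - u \<le> (real k + 1) * \<delta>"
      using Suc.prems \<open>0 < \<delta>\<close> by (auto simp: u_def min_def algebra_simps)
    have "N s b \<le> N s u + N u b" using subadd u by blast
    also have "N s u \<le> X" using piece[of s u] Suc.prems u by auto
    also have "N u b \<le> (real k + 1) * X" using Suc.IH[of u] Suc.prems u by auto
    finally show ?case by (simp add: algebra_simps)
  qed
  define k where "k = nat \<lfloor>(b - a) / \<delta>\<rfloor>"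
  have q: "0 \<le> (b - a) / \<delta>" using assms by simp
  then have k: "real k \<le> (b - a) / \<delta>" "(b - a) / \<delta> \<le> real k + 1"
    unfolding k_def by linarith+
  then have "b - a \<le> (real k + 1) * \<delta>" using \<open>0 < \<delta>\<close> by (simp add: field_simps)
  then have "N a b \<le> (real k + 1) * X" using * assms by blast
  also have "\<dots> \<le> ((b - a) / \<delta> + 1) * X"
    using k \<open>0 \<le> X\<close> by (intro mult_right_mono) auto
  finally show ?thesis .
qed

text \<open>Symmetrizing over the involution that exchanges colliding partners avoids choosing a
  representative of each pair; the factor 2 also fits fixed points.\<close>

lemma sum_involution:
  fixes f :: "'a \<Rightarrow> real"
  assumes "\<And>j. j \<in> F \<Longrightarrow> \<pi> j \<in> F" "\<And>j. j \<in> F \<Longrightarrow> \<pi> (\<pi> j) = j"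
  shows "2 * sum f F = (\<Sum>j\<in>F. f j + f (\<pi> j))"
proof -
  have "(\<Sum>j\<in>F. f (\<pi> j)) = sum f F"
    by (rule sum.reindex_bij_witness[of _ \<pi> \<pi>]) (use assms in auto)
  then show ?thesis by (simp add: sum.distrib)
qed

subsection \<open>Local structure of the motion\<close>

lemma eucl_dist_nonneg: "0 \<le> eucl_dist d p q"
  by (simp add: eucl_dist_def)

lemma eucl_dist_commute: "eucl_dist d p q = eucl_dist d q p"
  by (simp add: eucl_dist_def L2_set_def power2_commute)

lemma eucl_dist_self [simp]: "eucl_dist d p p = 0"
  by (simp add: eucl_dist_def L2_set_def)

lemma eucl_dist_triangle: "eucl_dist d p r \<le> eucl_dist d p q + eucl_dist d q r"
proof -
  have "eucl_dist d p r = L2_set (\<lambda>i. (p i - q i) + (q i - r i)) {..<d}"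
    by (simp add: eucl_dist_def)
  also have "\<dots> \<le> eucl_dist d p q + eucl_dist d q r"
    unfolding eucl_dist_def by (rule L2_set_triangle_ineq)
  finally show ?thesis .
qed

lemma eucl_dist_squared: "(eucl_dist d p q)\<^sup>2 = (\<Sum>i<d. (p i - q i)\<^sup>2)"
  by (simp add: eucl_dist_def L2_set_def sum_nonneg)

lemma collide_commute: "collide d x t j k \<longleftrightarrow> collide d x t k j"
  by (auto simp: collide_def eucl_dist_commute)

text \<open>By continuity at the endpoints \<open>f\<close> is affine on the closed interval, so its
  one-sided derivatives there equal \<open>v\<close>. This links the velocity on an open free
  interval to \<open>vel_before\<close> and \<open>vel_after\<close> at its ends.\<close>

lemma constant_velocity_segment:
  fixes f :: "real \<Rightarrow> real"
  assumes "a < b" and cont: "continuous_on {a..b} f"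
    and deriv: "\<And>s. a < s \<Longrightarrow> s < b \<Longrightarrow> (f has_real_derivative v) (at s)"
  shows "\<And>s. s \<in> {a..b} \<Longrightarrow> f s = f a + (s - a) * v"
    and "vector_derivative f (at_right a) = v"
    and "vector_derivative f (at_left b) = v"
proof -
  show affine: "f s = f a + (s - a) * v" if s: "s \<in> {a..b}" for s
  proof (cases "s = a")
    case False
    let ?g = "\<lambda>r. f r - (r - a) * v"
    have "?g s = ?g a"
    proof (rule DERIV_isconst_end[of a s ?g])
      show "a < s" using s False by auto
      show "continuous_on {a..s} ?g"
        using s by (intro continuous_intros continuous_on_subset[OF cont]) auto
      show "DERIV ?g r :> 0" if "a < r" "r < s" for r
        using deriv[of r] that s by (auto intro!: derivative_eq_intros)
    qed
    then show ?thesis by simp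
  qed simp
  \<comment> \<open>Inserting the base point leaves the filter unchanged, while transferring the
    derivative from the affine function to \<open>f\<close> needs that point in the set.\<close>
  have at: "at t within insert t S = at t within S" for t :: real and S
    by (simp add: at_within_def)
  have "((\<lambda>s. f a + (s - a) * v) has_vector_derivative v) (at a within insert a {a<..})"
    by (auto intro!: derivative_eq_intros simp: has_vector_derivative_def mult.commute)
  then have "(f has_vector_derivative v) (at a within insert a {a<..})"
  proof (rule has_vector_derivative_transform_within[of _ _ _ _ "b - a"])
    show "f a + (s - a) * v = f s" if "s \<in> insert a {a<..}" "dist s a < b - a" for s
      by (rule affine[symmetric]) (use that \<open>a < b\<close> in \<open>auto simp: dist_real_def\<close>)
  qed (use \<open>a < b\<close> in auto)
  then show "vector_derivative f (at_right a) = v"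
    unfolding at by (intro vector_derivative_within) auto
  have "((\<lambda>s. f a + (s - a) * v) has_vector_derivative v) (at b within insert b {..<b})"
    by (auto intro!: derivative_eq_intros simp: has_vector_derivative_def mult.commute)
  then have "(f has_vector_derivative v) (at b within insert b {..<b})"
  proof (rule has_vector_derivative_transform_within[of _ _ _ _ "b - a"])
    show "f a + (s - a) * v = f s" if "s \<in> insert b {..<b}" "dist s b < b - a" for s
      by (rule affine[symmetric]) (use that \<open>a < b\<close> in \<open>auto simp: dist_real_def\<close>)
  qed (use \<open>a < b\<close> in auto)
  then show "vector_derivative f (at_left b) = v"
    unfolding at by (intro vector_derivative_within) auto
qed

text \<open>The triangle inequality for one pair; the error of that pair is a subsum of the error
  over all pairs. A single estimate of the whole vector thus controls every distance.\<close>

lemma eucl_dist_le_scaled: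
  assumes "finite F" "j \<in> F" "k \<in> F" "0 \<le> l"
  shows "eucl_dist d (X j) (X k) \<le> l * eucl_dist d (Y j) (Y k)
    + sqrt (\<Sum>p\<in>F \<times> F \<times> {..<d}. (pairdiff X p - l * pairdiff Y p)\<^sup>2)"
proof -
  let ?g = "\<lambda>p. pairdiff X p - l * pairdiff Y p"
  have "eucl_dist d (X j) (X k) = L2_set (\<lambda>i. l * (Y j i - Y k i) + ?g (j, k, i)) {..<d}"
    by (simp add: eucl_dist_def pairdiff_def)
  also have "\<dots> \<le> L2_set (\<lambda>i. l * (Y j i - Y k i)) {..<d} + L2_set (\<lambda>i. ?g (j, k, i)) {..<d}"
    by (rule L2_set_triangle_ineq)
  also have "L2_set (\<lambda>i. l * (Y j i - Y k i)) {..<d} = l * eucl_dist d (Y j) (Y k)"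
    using \<open>0 \<le> l\<close> by (simp add: eucl_dist_def L2_set_right_distrib)
  also have "(\<Sum>i<d. (?g (j, k, i))\<^sup>2) = (\<Sum>p\<in>(\<lambda>i. (j, k, i)) ` {..<d}. (?g p)\<^sup>2)"
    by (subst sum.reindex) (auto simp: inj_on_def)
  then have "L2_set (\<lambda>i. ?g (j, k, i)) {..<d} = sqrt (\<Sum>p\<in>(\<lambda>i. (j, k, i)) ` {..<d}. (?g p)\<^sup>2)"
    by (simp add: L2_set_def)
  also have "\<dots> \<le> sqrt (\<Sum>p\<in>F \<times> F \<times> {..<d}. (?g p)\<^sup>2)"
    using assms by (intro real_sqrt_le_mono sum_mono2) auto
  finally show ?thesis by simp
qed

section \<open>Free flight, contacts and the collision law\<close>

locale nonsimultaneous_evolution = hard_ball_evolution +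
  assumes nonsimultaneous: "no_simultaneous_collisions n d x"
begin

lemma continuous_center_coordinate:
  assumes "k < n"
  shows "continuous_on A (\<lambda>t. x k t i)"
proof -
  have "continuous_map euclideanreal (powertop_real UNIV) (x k)"
    using continuous_centers[OF assms] by (auto simp: Euclidean_space_def continuous_map_in_subtopology)
  then have "continuous_map euclideanreal euclideanreal (\<lambda>t. x k t i)"
    by (simp add: continuous_map_componentwise_UNIV)
  then have "continuous_on UNIV (\<lambda>t. x k t i)" by simp
  then show ?thesis by (rule continuous_on_subset) simp
qed

lemma continuous_distance:
  assumes "j < n" "k < n"
  shows "continuous_on A (\<lambda>t. eucl_dist d (x j t) (x k t))"
  unfolding eucl_dist_def L2_set_def
  using assms by (intro continuous_intros continuous_center_coordinate)

lemma free_flight: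
  assumes "k < n" "a < b" and free: "\<And>t l. a < t \<Longrightarrow> t < b \<Longrightarrow> l < n \<Longrightarrow> \<not> collide d x t k l"
  shows "\<exists>v. \<forall>i<d. (\<forall>s\<in>{a..b}. x k s i = x k a i + (s - a) * v i) \<and>
    (\<forall>s\<in>{a..<b}. vel_after x k s i = v i) \<and> (\<forall>s\<in>{a<..b}. vel_before x k s i = v i)"
proof -
  obtain v where v: "\<And>t i. t \<in> {a<..<b} \<Longrightarrow> i < d \<Longrightarrow> ((\<lambda>s. x k s i) has_real_derivative v i) (at t)"
    using velocity_constant_between_collisions[of k a b] assms by (metis greaterThanLessThan_iff)
  have cont: "continuous_on A (\<lambda>s. x k s i)" for A i
    using continuous_center_coordinate \<open>k < n\<close> by simp
  show ?thesis
  proof (intro exI[of _ v] allI impI conjI ballI)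
    fix i assume "i < (d::nat)"
    note seg = constant_velocity_segment[OF _ cont, of _ _ i "v i"]
    show "x k s i = x k a i + (s - a) * v i" if "s \<in> {a..b}" for s
      using seg(1)[of a b s] v \<open>i < d\<close> \<open>a < b\<close> that by simp
    show "vel_after x k s i = v i" if "s \<in> {a..<b}" for s
      using seg(2)[of s b] v \<open>i < d\<close> that unfolding vel_after_def by simp
    show "vel_before x k s i = v i" if "s \<in> {a<..b}" for s
      using seg(3)[of a s] v \<open>i < d\<close> that unfolding vel_before_def by simp
  qed
qed

text \<open>Two distinct neighbours would make \<open>{j, k, l}\<close> a cluster of three balls
  linked by contacts. So the contacts at any instant form a matching.\<close>

lemma contact_unique:
  assumes "j < n" "k < n" "l < n"
    and "eucl_dist d (x j t) (x k t) = 2" "eucl_dist d (x j t) (x l t) = 2"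
  shows "k = l"
proof (rule ccontr)
  assume "k \<noteq> l"
  have "j \<noteq> k" "j \<noteq> l" using assms by auto
  then have card: "card {j, k, l} = 3" using \<open>k \<noteq> l\<close> by simp
  have e: "(j, k) \<in> contact n d x t" "(k, j) \<in> contact n d x t"
    "(j, l) \<in> contact n d x t" "(l, j) \<in> contact n d x t"
    using assms by (auto simp: contact_def eucl_dist_commute)
  then have "\<forall>p\<in>{j, k, l}. \<forall>q\<in>{j, k, l}. (p, q) \<in> (contact n d x t)\<^sup>*"
    by (auto intro: rtrancl_trans)
  then show False
    using nonsimultaneous card assms(1-3) unfolding no_simultaneous_collisions_def
    by (metis empty_subsetI insert_subset lessThan_iff order_refl)
qed

lemma collide_unique:
  assumes "j < n" "k < n" "l < n" "collide d x t j k" "collide d x t j l"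
  shows "k = l"
  using assms contact_unique by (auto simp: collide_def)

text \<open>The impulse is a multiple of the difference \<open>u\<close> of the centers. As
  \<open>u\<close> has length 2, the unit normal is \<open>u / 2\<close>, and the two halvings give
  the 4 in \<open>c = (b - a) / 4\<close>; this is positive because the pair is approaching.\<close>

lemma collision_law:
  assumes "j < n" "k < n" and col: "collide d x t j k"
  shows "\<exists>c>0. (\<Sum>i<d. (x j t i - x k t i)\<^sup>2) = 4 \<and>
    (\<Sum>i<d. (vel_before x j t i - vel_before x k t i) * (x j t i - x k t i)) = - 4 * c \<and>
    (\<forall>i<d. vel_after x j t i = vel_before x j t i + c * (x j t i - x k t i) \<and>
      vel_after x k t i = vel_before x k t i - c * (x j t i - x k t i))"
proof -
  define u where "u i = x j t i - x k t i" for i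
  define a b where "a = (\<Sum>i<d. vel_before x j t i * u i)" and "b = (\<Sum>i<d. vel_before x k t i * u i)"
  have dist: "eucl_dist d (x j t) (x k t) = 2" using col by (simp add: collide_def)
  have inner: "eucl_inner d w (unit_dir d x t j k) = (\<Sum>i<d. w i * u i) / 2" for w
    unfolding eucl_inner_def unit_dir_def dist u_def by (simp add: sum_divide_distrib)
  have rel: "(\<Sum>i<d. (vel_before x j t i - vel_before x k t i) * u i) = a - b"
    by (simp add: a_def b_def left_diff_distrib sum_subtractf)
  have "a - b < 0"
    using incoming[OF assms] rel by (simp add: eucl_inner_def u_def)
  show ?thesis
  proof (intro exI[of _ "(b - a) / 4"] conjI allI impI)
    show "0 < (b - a) / 4" using \<open>a - b < 0\<close> by simp
    show "(\<Sum>i<d. (x j t i - x k t i)\<^sup>2) = 4"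
      using eucl_dist_squared[of d "x j t" "x k t"] dist by simp
    show "(\<Sum>i<d. (vel_before x j t i - vel_before x k t i) * (x j t i - x k t i)) = - 4 * ((b - a) / 4)"
      using rel by (simp add: u_def)
    fix i assume "i < d"
    note el = elastic[OF assms \<open>i < d\<close>, unfolded inner, folded a_def b_def]
    have "unit_dir d x t j k i = u i / 2" unfolding unit_dir_def dist u_def ..
    with el show "vel_after x j t i = vel_before x j t i + (b - a) / 4 * (x j t i - x k t i)"
      "vel_after x k t i = vel_before x k t i - (b - a) / 4 * (x j t i - x k t i)"
      by (auto simp: u_def field_simps)
  qed
qed

text \<open>
  After a collision the two balls recede from each other; as long as neither meets another ball,
  their distance keeps increasing.
\<close>

lemma isolated_pair_collides_once:
  assumes jk: "j < n" "k < n"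
    and iso: "\<And>t l. t \<in> {a<..<b} \<Longrightarrow> l < n \<Longrightarrow> collide d x t j l \<Longrightarrow> l = k"
      "\<And>t l. t \<in> {a<..<b} \<Longrightarrow> l < n \<Longrightarrow> collide d x t k l \<Longrightarrow> l = j"
    and s: "s \<in> {a<..<b}" "collide d x s j k" and s': "s' \<in> {a<..<b}" "collide d x s' j k" and "s < s'"
  shows False
proof -
  define D where "D r = (\<Sum>i<d. (x j r i - x k r i)\<^sup>2)" for r
  have contact: "D r = 4" if "collide d x r j k" for r
    using that eucl_dist_squared[of d "x j r" "x k r"] by (simp add: D_def collide_def)
  define w where "w i = vel_after x j s i - vel_after x k s i" for i
  obtain c where c: "0 < c"
    "(\<Sum>i<d. (x j s i - x k s i)\<^sup>2) = 4"
    "(\<Sum>i<d. (vel_before x j s i - vel_before x k s i) * (x j s i - x k s i)) = - 4 * c"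
    "\<forall>i<d. vel_after x j s i = vel_before x j s i + c * (x j s i - x k s i) \<and>
      vel_after x k s i = vel_before x k s i - c * (x j s i - x k s i)"
    using collision_law[OF jk s(2)] by blast
  have "(\<Sum>i<d. w i * (x j s i - x k s i)) = (\<Sum>i<d.
      (vel_before x j s i - vel_before x k s i) * (x j s i - x k s i) + 2 * c * (x j s i - x k s i)\<^sup>2)"
    by (intro sum.cong) (auto simp: w_def c(4) power2_eq_square algebra_simps)
  also have "\<dots> = 4 * c"
    using c(2,3) by (simp add: sum.distrib flip: sum_distrib_left)
  finally have out: "(\<Sum>i<d. w i * (x j s i - x k s i)) = 4 * c" .
  have deriv: "((\<lambda>r. x l r i) has_real_derivative vel_after x l s i) (at_right s)" if "l < n" "i < d" for l i
    using one_sided_velocities[OF that, of s]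
    by (simp add: vel_after_def has_real_derivative_iff_has_vector_derivative vector_derivative_works)
  have "(D has_real_derivative (\<Sum>i<d. 2 * (x j s i - x k s i) * w i)) (at_right s)"
    unfolding D_def w_def using jk
    by (auto intro!: derivative_eq_intros deriv sum.cong)
  moreover have "(\<Sum>i<d. 2 * (x j s i - x k s i) * w i) = 8 * c"
  proof -
    have "(\<Sum>i<d. 2 * (x j s i - x k s i) * w i) = 2 * (\<Sum>i<d. w i * (x j s i - x k s i))"
      unfolding sum_distrib_left by (intro sum.cong) auto
    then show ?thesis using out by simp
  qed
  ultimately have "(D has_real_derivative 8 * c) (at_right s)" by simp
  then obtain e where e: "0 < e" "\<And>h. 0 < h \<Longrightarrow> h < e \<Longrightarrow> D s < D (s + h)"
    using has_real_derivative_pos_inc_right[of D "8 * c" s "{s<..}"] \<open>0 < c\<close>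
    by (auto simp: add.commute)
  have cont: "continuous_on A D" for A
    unfolding D_def using jk by (intro continuous_intros continuous_center_coordinate)
  have far: "s + e \<le> r" if "D r = 4" "s < r" for r
    using e(2)[of "r - s"] contact[OF s(2)] that by (cases "r < s + e") auto
  \<comment> \<open>By \<open>far\<close> no contact occurs before \<open>s + e\<close>, so the
    later contact times up to \<open>s'\<close> form a compact set with a first element
    \<open>p\<close>. Before \<open>p\<close> both balls fly freely, which forces
    \<open>D p > 4\<close> although \<open>p\<close> is a contact.\<close>
  define Z where "Z = {r \<in> {s + e..s'}. D r = 4}"
  have "closed Z"
    unfolding Z_def using continuous_closed_preimage_constant[OF cont, of "{s + e..s'}" 4] by simp
  moreover have "Z = Z \<inter> {s + e..s'}" by (auto simp: Z_def)
  ultimately have "compact Z"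
    by (metis closed_Int_compact compact_Icc)
  moreover have "s' \<in> Z" using far[of s'] contact[OF s'(2)] \<open>s < s'\<close> by (simp add: Z_def)
  ultimately obtain p where p: "p \<in> Z" "\<And>r. r \<in> Z \<Longrightarrow> p \<le> r"
    by (metis compact_attains_inf empty_iff)
  have p': "s < p" "p \<le> s'" "D p = 4" using p(1) e(1) by (auto simp: Z_def)
  have free: "D r \<noteq> 4" if "s < r" "r < p" for r
    using p(2)[of r] far[of r] that p' by (auto simp: Z_def)
  have mid: "r \<in> {a<..<b}" if "s < r" "r < p" for r
    using that s s' p' by auto
  have none: "\<not> collide d x r j l" "\<not> collide d x r k l" if r: "s < r" "r < p" and l: "l < n" for r l
  proof -
    have "\<not> collide d x r j k" "\<not> collide d x r k j"
      using contact[of r] free[OF r] collide_commute[of d x r j k] by blast+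
    then show "\<not> collide d x r j l" "\<not> collide d x r k l"
      using iso[OF mid[OF r] l] by blast+
  qed
  have ends: "p \<in> {s..p}" "s \<in> {s..<p}" using p'(1) by auto
  obtain v where v: "\<And>i. i < d \<Longrightarrow> x j p i = x j s i + (p - s) * v i \<and> vel_after x j s i = v i"
    using free_flight[OF jk(1) p'(1) none(1)] ends by blast
  obtain v' where v': "\<And>i. i < d \<Longrightarrow> x k p i = x k s i + (p - s) * v' i \<and> vel_after x k s i = v' i"
    using free_flight[OF jk(2) p'(1) none(2)] ends by blast
  have "D p = (\<Sum>i<d. (x j s i - x k s i)\<^sup>2 + 2 * (p - s) * (w i * (x j s i - x k s i)) + (p - s)\<^sup>2 * (w i)\<^sup>2)"
    unfolding D_def
    by (intro sum.cong) (auto simp: v v' w_def power2_eq_square algebra_simps)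
  also have "\<dots> = 4 + 2 * (p - s) * (4 * c) + (p - s)\<^sup>2 * (\<Sum>i<d. (w i)\<^sup>2)"
    using c(2) out by (simp add: sum.distrib flip: sum_distrib_left)
  also have "\<dots> > 4"
  proof -
    have "0 < (p - s) * c" using p' \<open>0 < c\<close> by simp
    moreover have "0 \<le> (p - s)\<^sup>2 * (\<Sum>i<d. (w i)\<^sup>2)" by (simp add: sum_nonneg)
    ultimately show ?thesis by linarith
  qed
  finally show False using p' by simp
qed

text \<open>Near \<open>t\<close> only pairs touching at \<open>t\<close> can touch, and these form
  a matching. Each such pair is therefore isolated on a neighbourhood and collides there at most
  once.\<close>

lemma no_collisions_nearby:
  "eventually (\<lambda>s. \<forall>j<n. \<forall>k<n. \<not> collide d x s j k) (at t)"
proof -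
  have noncontact: "eventually (\<lambda>s. eucl_dist d (x j s) (x k s) \<noteq> 2) (nhds t)"
    if "j < n" "k < n" "eucl_dist d (x j t) (x k t) \<noteq> 2" for j k
  proof -
    have "closed {s. eucl_dist d (x j s) (x k s) = 2}"
      by (intro closed_Collect_eq continuous_distance continuous_on_const that)
    then have "open {s. eucl_dist d (x j s) (x k s) \<noteq> 2}"
      by (simp add: closed_def Collect_neg_eq[symmetric])
    from eventually_nhds_in_open[OF this, of t] that(3) show ?thesis by simp
  qed
  have "eventually (\<lambda>s. \<forall>p\<in>{..<n} \<times> {..<n}. eucl_dist d (x (fst p) t) (x (snd p) t) \<noteq> 2 \<longrightarrow>
      eucl_dist d (x (fst p) s) (x (snd p) s) \<noteq> 2) (nhds t)"
    by (rule eventually_ball_finite) (auto intro: noncontact)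
  then obtain e where "e > 0" and e: "\<And>s j k. dist s t < e \<Longrightarrow> j < n \<Longrightarrow> k < n \<Longrightarrow>
      eucl_dist d (x j s) (x k s) = 2 \<Longrightarrow> eucl_dist d (x j t) (x k t) = 2"
    unfolding eventually_nhds_metric by fastforce
  have once: False if "j < n" "k < n" "collide d x s j k" "collide d x s' j k" "s < s'"
    "t - e < s" "s' < t + e" for j k s s'
  proof (rule isolated_pair_collides_once[OF that(1,2), where s = s and s' = s' and a = "t - e" and b = "t + e"])
    have jk: "eucl_dist d (x j t) (x k t) = 2"
      using e[of s j k] that by (auto simp: collide_def dist_real_def)
    fix r l assume r: "r \<in> {t - e<..<t + e}" and "l < n"
    then have r': "dist r t < e" by (auto simp: dist_real_def)
    show "l = k" if "collide d x r j l"
      using contact_unique[of j l k t] jk e[OF r', of j l] that \<open>j < n\<close> \<open>k < n\<close> \<open>l < n\<close>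
      by (auto simp: collide_def)
    show "l = j" if "collide d x r k l"
      using contact_unique[of k l j t] jk e[OF r', of k l] that \<open>j < n\<close> \<open>k < n\<close> \<open>l < n\<close>
      by (auto simp: collide_def eucl_dist_commute)
  qed (use that in auto)
  have pair: "eventually (\<lambda>s. \<not> collide d x s j k) (at t)" if jk: "j < n" "k < n" for j k
  proof -
    have "\<exists>b>t. \<forall>s>t. s < b \<longrightarrow> \<not> collide d x s j k"
    proof (cases "\<exists>s. t < s \<and> s < t + e \<and> collide d x s j k")
      case True
      then obtain s where "t < s" "s < t + e" "collide d x s j k" by blast
      then show ?thesis using once[OF jk, of _ s] \<open>e > 0\<close> by (intro exI[of _ s]) fastforce
    next
      case False
      then show ?thesis using \<open>e > 0\<close> by (intro exI[of _ "t + e"]) auto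
    qed
    moreover have "\<exists>b<t. \<forall>s>b. s < t \<longrightarrow> \<not> collide d x s j k"
    proof (cases "\<exists>s. t - e < s \<and> s < t \<and> collide d x s j k")
      case True
      then obtain s where "t - e < s" "s < t" "collide d x s j k" by blast
      then show ?thesis using once[OF jk, of s] \<open>e > 0\<close> by (intro exI[of _ s]) fastforce
    next
      case False
      then show ?thesis using \<open>e > 0\<close> by (intro exI[of _ "t - e"]) auto
    qed
    ultimately show ?thesis
      by (auto simp: eventually_at_split eventually_at_right_field eventually_at_left_field)
  qed
  have "eventually (\<lambda>s. \<forall>p\<in>{..<n} \<times> {..<n}. \<not> collide d x s (fst p) (snd p)) (at t)"
    by (rule eventually_ball_finite) (auto intro: pair)
  then show ?thesis by (rule eventually_mono) auto
qed

lemma finite_collisions_Icc: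
  assumes "F \<subseteq> {..<n}"
  shows "finite (collisions d x F {a..b})"
proof -
  define C where "C = {t. \<exists>j<n. \<exists>k<n. collide d x t j k}"
  have "\<not> t islimpt C" for t
    using no_collisions_nearby[of t] by (auto simp: C_def islimpt_iff_eventually elim: eventually_mono)
  then have "finite ({a..b} \<inter> C)"
    by (intro finite_not_islimpt_in_compact) auto
  then have "finite (Pow {..<n} \<times> ({a..b} \<inter> C))" by simp
  moreover have "collisions d x F {a..b} \<subseteq> Pow {..<n} \<times> ({a..b} \<inter> C)"
    using assms by (auto simp: collisions_def C_def)
  ultimately show ?thesis by (rule rev_finite_subset)
qed

subsection \<open>Isolated families\<close>

definition isolated :: "nat set \<Rightarrow> real set \<Rightarrow> bool" where
  "isolated F T \<longleftrightarrow> F \<subseteq> {..<n} \<and> (\<forall>t\<in>T. \<forall>j\<in>F. \<forall>k<n. collide d x t j k \<longrightarrow> k \<in> F)"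

text \<open>For unit masses, \<open>2 * card F\<close> times the moment of inertia about the center
  of mass.\<close>

definition inertia :: "nat set \<Rightarrow> real \<Rightarrow> real" where
  "inertia F t = (\<Sum>p\<in>F \<times> F \<times> {..<d}. (pairdiff (\<lambda>k. x k t) p)\<^sup>2)"

text \<open>For unit masses, \<open>4 * card F\<close> times the kinetic energy in the
  center-of-mass frame. For an isolated family \<open>vel_before\<close> gives the same value, by
  \<open>isolated_jump\<close>.\<close>

definition energy :: "nat set \<Rightarrow> real \<Rightarrow> real" where
  "energy F t = (\<Sum>p\<in>F \<times> F \<times> {..<d}. (pairdiff (\<lambda>k. vel_after x k t) p)\<^sup>2)"

lemma isolated_subset: "isolated F T \<Longrightarrow> T' \<subseteq> T \<Longrightarrow> isolated F T'"
  by (auto simp: isolated_def)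

lemma isolated_finite: "isolated F T \<Longrightarrow> finite F"
  unfolding isolated_def using finite_subset by blast

text \<open>A punctured neighbourhood has no collisions, so each side is one free flight. The last
  clause expresses \<open>vel_after\<close> at times before \<open>t\<close> by
  \<open>vel_before\<close> at \<open>t\<close>, which lets \<open>energy\<close> be compared across
  a collision.\<close>

lemma local_motion:
  "\<exists>\<epsilon>>0. \<forall>k<n. \<forall>i<d. \<forall>h. 0 < h \<and> h < \<epsilon> \<longrightarrow>
    x k (t + h) i = x k t i + h * vel_after x k t i \<and> vel_after x k (t + h) i = vel_after x k t i \<and>
    x k (t - h) i = x k t i - h * vel_before x k t i \<and> vel_after x k (t - h) i = vel_before x k t i"
proof -
  obtain e where "0 < e"
    and e: "\<And>s j k. s \<noteq> t \<Longrightarrow> dist s t < e \<Longrightarrow> j < n \<Longrightarrow> k < n \<Longrightarrow> \<not> collide d x s j k"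
    using no_collisions_nearby[of t] unfolding eventually_at by auto
  show ?thesis
  proof (intro exI[of _ e] conjI[OF \<open>0 < e\<close>] allI impI)
    fix k i h assume k: "k < n" and i: "i < d" and "0 < h \<and> h < e"
    then have h: "0 < h" "h < e" by auto
    have "t < t + e" "t - e < t" using \<open>0 < e\<close> by auto
    have right: "\<not> collide d x s k l" if "t < s" "s < t + e" "l < n" for s l
      using e[of s k l] k that by (simp add: dist_real_def)
    have left: "\<not> collide d x s k l" if "t - e < s" "s < t" "l < n" for s l
      using e[of s k l] k that by (simp add: dist_real_def)
    obtain v where "\<forall>i<d. (\<forall>s\<in>{t..t + e}. x k s i = x k t i + (s - t) * v i) \<and>
        (\<forall>s\<in>{t..<t + e}. vel_after x k s i = v i) \<and> (\<forall>s\<in>{t<..t + e}. vel_before x k s i = v i)"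
      using free_flight[OF k \<open>t < t + e\<close> right] ..
    note v = this[rule_format, OF i, THEN conjunct1, rule_format]
      this[rule_format, OF i, THEN conjunct2, THEN conjunct1, rule_format]
    have "t + h \<in> {t..t + e}" "t + h \<in> {t..<t + e}" "t \<in> {t..<t + e}" using h by auto
    then have "x k (t + h) i = x k t i + h * vel_after x k t i" "vel_after x k (t + h) i = vel_after x k t i"
      using v(1)[of "t + h"] v(2)[of "t + h"] v(2)[of t] by simp_all
    moreover
    obtain w where "\<forall>i<d. (\<forall>s\<in>{t - e..t}. x k s i = x k (t - e) i + (s - (t - e)) * w i) \<and>
        (\<forall>s\<in>{t - e..<t}. vel_after x k s i = w i) \<and> (\<forall>s\<in>{t - e<..t}. vel_before x k s i = w i)"
      using free_flight[OF k \<open>t - e < t\<close> left] ..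
    note w = this[rule_format, OF i, THEN conjunct1, rule_format]
      this[rule_format, OF i, THEN conjunct2, THEN conjunct1, rule_format]
      this[rule_format, OF i, THEN conjunct2, THEN conjunct2, rule_format]
    have "t \<in> {t - e..t}" "t - h \<in> {t - e..t}" "t - h \<in> {t - e..<t}" "t \<in> {t - e<..t}" using h by auto
    then have "x k t i = x k (t - e) i + e * w i" "x k (t - h) i = x k (t - e) i + (e - h) * w i"
      "vel_after x k (t - h) i = w i" "vel_before x k t i = w i"
      using w(1)[of t] w(1)[of "t - h"] w(2)[of "t - h"] w(3)[of t] by simp_all
    then have "x k (t - h) i = x k t i - h * vel_before x k t i" "vel_after x k (t - h) i = vel_before x k t i"
      by (simp_all add: algebra_simps)
    ultimately show "x k (t + h) i = x k t i + h * vel_after x k t i \<and> vel_after x k (t + h) i = vel_after x k t i \<and>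
      x k (t - h) i = x k t i - h * vel_before x k t i \<and> vel_after x k (t - h) i = vel_before x k t i"
      by blast
  qed
qed

lemma velocity_unchanged:
  assumes "k < n" "i < d" and free: "\<And>l. l < n \<Longrightarrow> \<not> collide d x t k l"
  shows "vel_after x k t i = vel_before x k t i"
proof -
  obtain e where "0 < e"
    and e: "\<And>s j k. s \<noteq> t \<Longrightarrow> dist s t < e \<Longrightarrow> j < n \<Longrightarrow> k < n \<Longrightarrow> \<not> collide d x s j k"
    using no_collisions_nearby[of t] unfolding eventually_at by auto
  have "\<not> collide d x s k l" if "t - e < s" "s < t + e" "l < n" for s l
    using e[of s k l] free[of l] that \<open>k < n\<close> by (cases "s = t") (auto simp: dist_real_def)
  moreover have "t - e < t + e" "t \<in> {t - e..<t + e}" "t \<in> {t - e<..t + e}" using \<open>0 < e\<close> by auto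
  ultimately show ?thesis
    using free_flight[of k "t - e" "t + e"] assms(1,2) by metis
qed

text \<open>\<open>THE\<close> is meaningful by \<open>collide_unique\<close>; the default
  \<open>j\<close> makes the map an involution on all balls.\<close>

definition partner :: "real \<Rightarrow> nat \<Rightarrow> nat" where
  "partner t j = (if \<exists>k<n. collide d x t j k then THE k. k < n \<and> collide d x t j k else j)"

lemma partner_eq:
  assumes "j < n" "k < n" "collide d x t j k"
  shows "partner t j = k"
proof -
  have "(THE k. k < n \<and> collide d x t j k) = k"
    using assms by (intro the_equality) (auto intro: collide_unique)
  then show ?thesis using assms by (auto simp: partner_def)
qed

lemma partner_involution:
  assumes "j < n"
  shows "partner t (partner t j) = j"
proof (cases "\<exists>k<n. collide d x t j k")
  case True
  then obtain k where "k < n" "collide d x t j k" by blast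
  moreover then have "collide d x t k j" by (simp add: collide_commute)
  ultimately show ?thesis using assms by (metis partner_eq)
next
  case False
  then have "partner t j = j" unfolding partner_def by (rule if_not_P)
  then show ?thesis by simp
qed

lemma partner_in_isolated:
  assumes "isolated F {t}" "j \<in> F"
  shows "partner t j \<in> F"
proof (cases "\<exists>k<n. collide d x t j k")
  case True
  then obtain k where "k < n" "collide d x t j k" by blast
  with assms show ?thesis using partner_eq[of j k t] by (auto simp: isolated_def)
next
  case False
  then have "partner t j = j" unfolding partner_def by (rule if_not_P)
  then show ?thesis using assms by simp
qed

text \<open>The impulses are opposite. In the kinetic energy the cross term
  \<open>2 * c * (- 4 * c)\<close> cancels \<open>2 * c ^ 2 * 4\<close>; the last sum grows by
  \<open>c\<close> times the squared distance, that is by \<open>4 * c > 0\<close>. A ball without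
  collision is its own partner, and nothing changes.\<close>

lemma partner_exchange:
  fixes t :: real
  assumes "j < n"
  defines "k \<equiv> partner t j"
  shows "\<And>i. i < d \<Longrightarrow> vel_after x j t i + vel_after x k t i = vel_before x j t i + vel_before x k t i"
    and "(\<Sum>i<d. (vel_after x j t i)\<^sup>2) + (\<Sum>i<d. (vel_after x k t i)\<^sup>2) =
      (\<Sum>i<d. (vel_before x j t i)\<^sup>2) + (\<Sum>i<d. (vel_before x k t i)\<^sup>2)"
    and "(\<Sum>i<d. x j t i * vel_before x j t i) + (\<Sum>i<d. x k t i * vel_before x k t i) \<le>
      (\<Sum>i<d. x j t i * vel_after x j t i) + (\<Sum>i<d. x k t i * vel_after x k t i)"
proof -
  have "(\<forall>i<d. vel_after x j t i + vel_after x k t i = vel_before x j t i + vel_before x k t i) \<and>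
    (\<Sum>i<d. (vel_after x j t i)\<^sup>2) + (\<Sum>i<d. (vel_after x k t i)\<^sup>2) =
      (\<Sum>i<d. (vel_before x j t i)\<^sup>2) + (\<Sum>i<d. (vel_before x k t i)\<^sup>2) \<and>
    (\<Sum>i<d. x j t i * vel_before x j t i) + (\<Sum>i<d. x k t i * vel_before x k t i) \<le>
      (\<Sum>i<d. x j t i * vel_after x j t i) + (\<Sum>i<d. x k t i * vel_after x k t i)"
  proof (cases "\<exists>l<n. collide d x t j l")
    case False
    then have "k = j" "\<And>i. i < d \<Longrightarrow> vel_after x j t i = vel_before x j t i"
      using velocity_unchanged[OF \<open>j < n\<close>] by (auto simp: k_def partner_def)
    then show ?thesis by simp
  next
    case True
    then obtain l where "l < n" "collide d x t j l" by blast
    then have k: "k < n" "collide d x t j k"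
      using partner_eq[OF \<open>j < n\<close>] by (auto simp: k_def)
    let ?u = "\<lambda>i. x j t i - x k t i"
    obtain c where c: "0 < c" "(\<Sum>i<d. (?u i)\<^sup>2) = 4"
      "(\<Sum>i<d. (vel_before x j t i - vel_before x k t i) * ?u i) = - 4 * c"
      "\<forall>i<d. vel_after x j t i = vel_before x j t i + c * ?u i \<and>
        vel_after x k t i = vel_before x k t i - c * ?u i"
      using collision_law[OF \<open>j < n\<close> k] by blast
    have "(\<Sum>i<d. (vel_after x j t i)\<^sup>2) + (\<Sum>i<d. (vel_after x k t i)\<^sup>2) =
      (\<Sum>i<d. (vel_before x j t i)\<^sup>2 + (vel_before x k t i)\<^sup>2
        + 2 * c * ((vel_before x j t i - vel_before x k t i) * ?u i) + 2 * c\<^sup>2 * (?u i)\<^sup>2)"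
      unfolding sum.distrib[symmetric]
      by (intro sum.cong) (auto simp: c(4) power2_eq_square algebra_simps)
    also have "\<dots> = (\<Sum>i<d. (vel_before x j t i)\<^sup>2) + (\<Sum>i<d. (vel_before x k t i)\<^sup>2)"
      using c(2,3) by (simp add: sum.distrib power2_eq_square flip: sum_distrib_left)
    finally have kinetic: "(\<Sum>i<d. (vel_after x j t i)\<^sup>2) + (\<Sum>i<d. (vel_after x k t i)\<^sup>2) =
      (\<Sum>i<d. (vel_before x j t i)\<^sup>2) + (\<Sum>i<d. (vel_before x k t i)\<^sup>2)" .
    have "(\<Sum>i<d. x j t i * vel_after x j t i) + (\<Sum>i<d. x k t i * vel_after x k t i) =
      (\<Sum>i<d. x j t i * vel_before x j t i + x k t i * vel_before x k t i + c * (?u i)\<^sup>2)"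
      unfolding sum.distrib[symmetric]
      by (intro sum.cong) (auto simp: c(4) power2_eq_square algebra_simps)
    also have "\<dots> = (\<Sum>i<d. x j t i * vel_before x j t i) + (\<Sum>i<d. x k t i * vel_before x k t i) + c * 4"
      using c(2) by (simp add: sum.distrib flip: sum_distrib_left)
    finally show ?thesis using kinetic c(1,4) by simp
  qed
  then show "\<And>i. i < d \<Longrightarrow> vel_after x j t i + vel_after x k t i = vel_before x j t i + vel_before x k t i"
    and "(\<Sum>i<d. (vel_after x j t i)\<^sup>2) + (\<Sum>i<d. (vel_after x k t i)\<^sup>2) =
      (\<Sum>i<d. (vel_before x j t i)\<^sup>2) + (\<Sum>i<d. (vel_before x k t i)\<^sup>2)"
    and "(\<Sum>i<d. x j t i * vel_before x j t i) + (\<Sum>i<d. x k t i * vel_before x k t i) \<le>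
      (\<Sum>i<d. x j t i * vel_after x j t i) + (\<Sum>i<d. x k t i * vel_after x k t i)"
    by blast+
qed

text \<open>\<open>partner\<close> maps \<open>F\<close> to itself, so sums over balls reduce to
  single exchanges, and the identity for pair sums transfers them to relative vectors. The sums in
  the second claim are half the one-sided slopes of \<open>inertia\<close>, which thus cannot
  drop.\<close>

lemma isolated_jump:
  assumes iso: "isolated F {t}"
  shows "(\<Sum>p\<in>F \<times> F \<times> {..<d}. (pairdiff (\<lambda>k. vel_before x k t) p)\<^sup>2) = energy F t"
    and "(\<Sum>p\<in>F \<times> F \<times> {..<d}. pairdiff (\<lambda>k. x k t) p * pairdiff (\<lambda>k. vel_before x k t) p) \<le>
      (\<Sum>p\<in>F \<times> F \<times> {..<d}. pairdiff (\<lambda>k. x k t) p * pairdiff (\<lambda>k. vel_after x k t) p)"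
proof -
  have F: "j < n" if "j \<in> F" for j using iso that by (auto simp: isolated_def)
  have inv: "2 * sum f F = (\<Sum>j\<in>F. f j + f (partner t j))" for f :: "nat \<Rightarrow> real"
    using partner_in_isolated[OF iso] partner_involution[OF F] by (intro sum_involution) auto
  have momentum: "(\<Sum>j\<in>F. vel_after x j t i) = (\<Sum>j\<in>F. vel_before x j t i)" if "i < d" for i
  proof -
    have "2 * (\<Sum>j\<in>F. vel_after x j t i) = 2 * (\<Sum>j\<in>F. vel_before x j t i)"
      unfolding inv using that by (intro sum.cong) (auto simp: F partner_exchange)
    then show ?thesis by simp
  qed
  have kinetic: "(\<Sum>j\<in>F. \<Sum>i<d. (vel_after x j t i)\<^sup>2) = (\<Sum>j\<in>F. \<Sum>i<d. (vel_before x j t i)\<^sup>2)"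
  proof -
    have "2 * (\<Sum>j\<in>F. \<Sum>i<d. (vel_after x j t i)\<^sup>2) = 2 * (\<Sum>j\<in>F. \<Sum>i<d. (vel_before x j t i)\<^sup>2)"
      unfolding inv by (intro sum.cong) (auto simp: F partner_exchange)
    then show ?thesis by simp
  qed
  have virial: "(\<Sum>j\<in>F. \<Sum>i<d. x j t i * vel_before x j t i) \<le> (\<Sum>j\<in>F. \<Sum>i<d. x j t i * vel_after x j t i)"
  proof -
    have "2 * (\<Sum>j\<in>F. \<Sum>i<d. x j t i * vel_before x j t i) \<le> 2 * (\<Sum>j\<in>F. \<Sum>i<d. x j t i * vel_after x j t i)"
      unfolding inv by (intro sum_mono) (auto simp: F partner_exchange)
    then show ?thesis by simp
  qed
  show "(\<Sum>p\<in>F \<times> F \<times> {..<d}. (pairdiff (\<lambda>k. vel_before x k t) p)\<^sup>2) = energy F t"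
    unfolding energy_def power2_eq_square sum_pairdiff_mult
    using kinetic momentum by (simp add: power2_eq_square)
  show "(\<Sum>p\<in>F \<times> F \<times> {..<d}. pairdiff (\<lambda>k. x k t) p * pairdiff (\<lambda>k. vel_before x k t) p) \<le>
      (\<Sum>p\<in>F \<times> F \<times> {..<d}. pairdiff (\<lambda>k. x k t) p * pairdiff (\<lambda>k. vel_after x k t) p)"
    unfolding sum_pairdiff_mult
    using virial momentum by (simp add: mult_left_mono)
qed

text \<open>Local constancy on a connected interval: to the right of an instant the velocities
  persist; to the left they are \<open>vel_before\<close>, which yields the same value by
  \<open>isolated_jump\<close>.\<close>

lemma energy_conserved:
  assumes iso: "isolated F {a..b}" and st: "s \<in> {a..b}" "t \<in> {a..b}"
  shows "energy F s = energy F t"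
proof (rule connected_local_const[of "{a..b}" s t "energy F"])
  show "\<forall>r\<in>{a..b}. eventually (\<lambda>q. energy F r = energy F q) (at r within {a..b})"
  proof
    fix r assume r: "r \<in> {a..b}"
    then have iso_r: "isolated F {r}" using isolated_subset[OF iso] by auto
    then have F: "j < n" if "j \<in> F" for j using that by (auto simp: isolated_def)
    obtain \<epsilon> where "0 < \<epsilon>" and motion: "\<forall>k<n. \<forall>i<d. \<forall>h. 0 < h \<and> h < \<epsilon> \<longrightarrow>
      x k (r + h) i = x k r i + h * vel_after x k r i \<and> vel_after x k (r + h) i = vel_after x k r i \<and>
      x k (r - h) i = x k r i - h * vel_before x k r i \<and> vel_after x k (r - h) i = vel_before x k r i"
      using local_motion[of r] by blast
    have "energy F r = energy F q" if q: "q \<noteq> r" "dist q r < \<epsilon>" for q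
    proof (cases "r < q")
      case True
      then have "vel_after x k q i = vel_after x k r i" if "k < n" "i < d" for k i
        using motion[rule_format, OF that, of "q - r"] True q by (simp add: dist_real_def)
      then show ?thesis
        unfolding energy_def by (intro sum.cong) (auto simp: pairdiff_def F)
    next
      case False
      then have "vel_after x k q i = vel_before x k r i" if "k < n" "i < d" for k i
        using motion[rule_format, OF that, of "r - q"] False q by (simp add: dist_real_def)
      then show ?thesis
        unfolding isolated_jump(1)[OF iso_r, symmetric] unfolding energy_def
        by (intro sum.cong) (auto simp: pairdiff_def F)
    qed
    then show "eventually (\<lambda>q. energy F r = energy F q) (at r within {a..b})"
      using \<open>0 < \<epsilon>\<close> by (auto simp: eventually_at)
  qed
qed (use st in auto)

lemma energy_nonneg: "0 \<le> energy F t"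
  by (simp add: energy_def sum_nonneg)

text \<open>Project onto the fixed displacement \<open>w\<close>. By Cauchy-Schwarz the projection
  grows at rate at most \<open>K = W * sqrt (energy F a)\<close>, so
  \<open>W ^ 2 \<le> K * (t - s)\<close>, and one factor \<open>W\<close> cancels.\<close>

lemma isolated_lipschitz:
  assumes iso: "isolated F {a..b}" and s: "s \<in> {a..b}" and t: "t \<in> {a..b}"
  shows "(\<Sum>p\<in>F \<times> F \<times> {..<d}. (pairdiff (\<lambda>k. x k t) p - pairdiff (\<lambda>k. x k s) p)\<^sup>2)
    \<le> energy F a * (t - s)\<^sup>2"
  using s t
proof (induction s t rule: linorder_wlog)
  case (le s t)
  let ?P = "F \<times> F \<times> {..<d}"
  let ?y = "\<lambda>t. pairdiff (\<lambda>k. x k t)"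
  define w where "w p = ?y t p - ?y s p" for p
  define W where "W = L2_set w ?P"
  define K where "K = W * sqrt (energy F a)"
  define f where "f r = (\<Sum>p\<in>?P. w p * ?y r p) - K * r" for r
  have F: "j < n" if "j \<in> F" for j using iso that by (auto simp: isolated_def)
  have cont: "continuous_on {s..t} f"
    unfolding f_def pairdiff_def case_prod_unfold
    by (intro continuous_intros continuous_center_coordinate) (auto simp: F)
  have "f t \<le> f s"
  proof (rule right_nonincreasing_imp_le[OF le(1) cont])
    fix r assume "s \<le> r" "r < t"
    then have r: "r \<in> {a..b}" using le by auto
    obtain \<epsilon> where "0 < \<epsilon>" and motion: "\<forall>k<n. \<forall>i<d. \<forall>h. 0 < h \<and> h < \<epsilon> \<longrightarrow>
      x k (r + h) i = x k r i + h * vel_after x k r i \<and> vel_after x k (r + h) i = vel_after x k r i \<and>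
      x k (r - h) i = x k r i - h * vel_before x k r i \<and> vel_after x k (r - h) i = vel_before x k r i"
      using local_motion[of r] by blast
    let ?v = "pairdiff (\<lambda>k. vel_after x k r)"
    have "(\<Sum>p\<in>?P. w p * ?v p) \<le> (\<Sum>p\<in>?P. \<bar>w p\<bar> * \<bar>?v p\<bar>)"
      by (intro sum_mono) (simp add: abs_mult[symmetric])
    also have "\<dots> \<le> W * L2_set ?v ?P"
      unfolding W_def by (rule L2_set_mult_ineq)
    also have "L2_set ?v ?P = sqrt (energy F a)"
      using energy_conserved[OF iso r, of a] r by (simp add: L2_set_def energy_def)
    finally have slope: "(\<Sum>p\<in>?P. w p * ?v p) \<le> K" by (simp add: K_def)
    have "f (r + h) \<le> f r" if h: "0 < h" "h < \<epsilon>" for h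
    proof -
      have "(\<Sum>p\<in>?P. w p * ?y (r + h) p) = (\<Sum>p\<in>?P. w p * ?y r p + h * (w p * ?v p))"
        using motion h by (intro sum.cong) (auto simp: pairdiff_def F algebra_simps)
      then have "f (r + h) = f r + h * ((\<Sum>p\<in>?P. w p * ?v p) - K)"
        by (simp add: f_def sum.distrib sum_distrib_left algebra_simps)
      also have "\<dots> \<le> f r" using slope h by (simp add: mult_nonneg_nonpos)
      finally show ?thesis .
    qed
    then show "\<exists>\<epsilon>>0. \<forall>h. 0 < h \<and> h < \<epsilon> \<longrightarrow> f (r + h) \<le> f r"
      using \<open>0 < \<epsilon>\<close> by blast
  qed
  moreover have "(\<Sum>p\<in>?P. w p * ?y t p) - (\<Sum>p\<in>?P. w p * ?y s p) = (\<Sum>p\<in>?P. (w p)\<^sup>2)"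
    unfolding sum_subtractf[symmetric]
    by (intro sum.cong) (auto simp: w_def power2_eq_square right_diff_distrib)
  then have "f t - f s = (\<Sum>p\<in>?P. (w p)\<^sup>2) - K * (t - s)"
    by (simp add: f_def right_diff_distrib)
  moreover have W2: "(\<Sum>p\<in>?P. (w p)\<^sup>2) = W\<^sup>2"
    by (simp add: W_def L2_set_def sum_nonneg)
  ultimately have "W * W \<le> W * (sqrt (energy F a) * (t - s))"
    by (simp add: K_def power2_eq_square algebra_simps)
  moreover have "0 \<le> W" by (simp add: W_def)
  ultimately have "W \<le> sqrt (energy F a) * (t - s)"
    using le(1) energy_nonneg[of F a] by (cases "W = 0") (auto simp: mult_le_cancel_left)
  then have "W\<^sup>2 \<le> (sqrt (energy F a) * (t - s))\<^sup>2"
    using \<open>0 \<le> W\<close> by (rule power_mono)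
  then show ?case
    using W2 energy_nonneg[of F a] by (simp add: w_def power_mult_distrib)
next
  case (sym s t)
  then show ?case by (simp add: power2_commute)
qed

section \<open>Convexity of the inertia in time\<close>

lemma continuous_inertia:
  assumes "F \<subseteq> {..<n}"
  shows "continuous_on A (inertia F)"
  unfolding inertia_def[abs_def] pairdiff_def case_prod_unfold
  using assms by (intro continuous_intros continuous_center_coordinate) auto

text \<open>Around each instant the inertia is quadratic on either side with leading coefficient
  \<open>energy F a\<close>, and its slope can only jump upwards. Subtracting
  \<open>energy F a * t ^ 2\<close> therefore leaves a locally midpoint convex function.\<close>

lemma inertia_strongly_convex:
  assumes iso: "isolated F {a..b}" and st: "s \<in> {a..b}" "t \<in> {a..b}" and l: "0 \<le> l" "l \<le> 1"
  shows "inertia F (s + l * (t - s)) \<le>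
    (1 - l) * inertia F s + l * inertia F t - energy F a * l * (1 - l) * (t - s)\<^sup>2"
proof -
  let ?P = "F \<times> F \<times> {..<d}"
  let ?E = "energy F a"
  define g where "g t = inertia F t - ?E * t\<^sup>2" for t
  have F: "j < n" if "j \<in> F" for j using iso that by (auto simp: isolated_def)
  have "convex_on {a..b} g"
  proof (rule locally_midpoint_convex_imp_convex_on)
    show "continuous_on {a..b} g"
      unfolding g_def using F by (intro continuous_intros continuous_inertia) auto
    fix r assume "a < r" "r < b"
    then have r: "r \<in> {a..b}" by auto
    then have iso_r: "isolated F {r}" using isolated_subset[OF iso] by auto
    obtain \<epsilon> where "0 < \<epsilon>" and motion: "\<forall>k<n. \<forall>i<d. \<forall>h. 0 < h \<and> h < \<epsilon> \<longrightarrow>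
      x k (r + h) i = x k r i + h * vel_after x k r i \<and> vel_after x k (r + h) i = vel_after x k r i \<and>
      x k (r - h) i = x k r i - h * vel_before x k r i \<and> vel_after x k (r - h) i = vel_before x k r i"
      using local_motion[of r] by blast
    let ?y = "pairdiff (\<lambda>k. x k r)"
    let ?v = "pairdiff (\<lambda>k. vel_after x k r)"
    let ?w = "pairdiff (\<lambda>k. vel_before x k r)"
    have E: "(\<Sum>p\<in>?P. (?v p)\<^sup>2) = ?E" "(\<Sum>p\<in>?P. (?w p)\<^sup>2) = ?E"
      using energy_conserved[OF iso r, of a] r isolated_jump(1)[OF iso_r] by (auto simp: energy_def)
    have "2 * g r \<le> g (r - h) + g (r + h)" if h: "0 < h" "h < \<epsilon>" for h
    proof -
      have plus: "pairdiff (\<lambda>k. x k (r + h)) p = ?y p + h * ?v p"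
        and minus: "pairdiff (\<lambda>k. x k (r - h)) p = ?y p - h * ?w p" if "p \<in> ?P" for p
        using motion h that by (auto simp: pairdiff_def F right_diff_distrib)
      have "inertia F (r + h) = (\<Sum>p\<in>?P. (?y p)\<^sup>2 + 2 * h * (?y p * ?v p) + h\<^sup>2 * (?v p)\<^sup>2)"
        unfolding inertia_def
        by (intro sum.cong) (simp_all only: plus, simp add: power2_eq_square algebra_simps)
      also have "\<dots> = inertia F r + 2 * h * (\<Sum>p\<in>?P. ?y p * ?v p) + h\<^sup>2 * ?E"
        unfolding inertia_def E(1)[symmetric] by (simp add: sum.distrib sum_distrib_left)
      finally have "inertia F (r + h) = inertia F r + 2 * h * (\<Sum>p\<in>?P. ?y p * ?v p) + h\<^sup>2 * ?E" .
      moreover have "inertia F (r - h) = (\<Sum>p\<in>?P. (?y p)\<^sup>2 - 2 * h * (?y p * ?w p) + h\<^sup>2 * (?w p)\<^sup>2)"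
        unfolding inertia_def
        by (intro sum.cong) (simp_all only: minus, simp add: power2_eq_square algebra_simps)
      then have "inertia F (r - h) = inertia F r - 2 * h * (\<Sum>p\<in>?P. ?y p * ?w p) + h\<^sup>2 * ?E"
        unfolding inertia_def E(2)[symmetric] by (simp add: sum.distrib sum_subtractf sum_distrib_left)
      moreover have "2 * h * (\<Sum>p\<in>?P. ?y p * ?w p) \<le> 2 * h * (\<Sum>p\<in>?P. ?y p * ?v p)"
        using isolated_jump(2)[OF iso_r] h by (intro mult_left_mono) auto
      ultimately show ?thesis
        by (simp add: g_def power2_eq_square algebra_simps)
    qed
    then show "\<exists>\<epsilon>>0. \<forall>h. 0 < h \<and> h < \<epsilon> \<longrightarrow> 2 * g r \<le> g (r - h) + g (r + h)"
      using \<open>0 < \<epsilon>\<close> by blast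
  qed
  then have "g ((1 - l) *\<^sub>R s + l *\<^sub>R t) \<le> (1 - l) * g s + l * g t"
    using st l by (intro convex_onD) auto
  moreover have "(1 - l) *\<^sub>R s + l *\<^sub>R t = s + l * (t - s)"
    by (simp add: algebra_simps)
  ultimately have "inertia F (s + l * (t - s)) \<le> (1 - l) * inertia F s + l * inertia F t
      + ?E * ((s + l * (t - s))\<^sup>2 - (1 - l) * s\<^sup>2 - l * t\<^sup>2)"
    by (simp add: g_def algebra_simps)
  also have "(s + l * (t - s))\<^sup>2 - (1 - l) * s\<^sup>2 - l * t\<^sup>2 = - (l * (1 - l) * (t - s)\<^sup>2)"
    by (simp add: power2_eq_square algebra_simps)
  finally show ?thesis by (simp add: algebra_simps)
qed

text \<open>Zero energy means equal velocities just before a collision, against the strict approach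
  in \<open>incoming\<close>. This settles the case in which the time scale, a quotient by the root
  of the energy, is undefined.\<close>

lemma no_collisions_if_energy_zero:
  assumes iso: "isolated F {a..b}" and "energy F a = 0"
  shows "collisions d x F {a..b} = {}"
proof -
  have False if jk: "j \<in> F" "k \<in> F" and t: "t \<in> {a..b}" and col: "collide d x t j k" for j k t
  proof -
    let ?P = "F \<times> F \<times> {..<d}"
    have "isolated F {t}" using isolated_subset[OF iso] t by auto
    then have "(\<Sum>p\<in>?P. (pairdiff (\<lambda>k. vel_before x k t) p)\<^sup>2) = 0"
      using isolated_jump(1) energy_conserved[OF iso t, of a] t assms(2) by auto
    moreover have "finite ?P" using isolated_finite[OF iso] by simp
    ultimately have "\<forall>p\<in>?P. pairdiff (\<lambda>k. vel_before x k t) p = 0"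
      by (simp add: sum_nonneg_eq_0_iff)
    then have "pairdiff (\<lambda>k. vel_before x k t) (j, k, i) = 0" if "i < d" for i
      using jk that by blast
    then have "vel_before x j t i - vel_before x k t i = 0" if "i < d" for i
      using that by (simp add: pairdiff_def)
    moreover have "j < n" "k < n" using iso jk by (auto simp: isolated_def)
    ultimately show False
      using incoming[OF _ _ col] by (simp add: eucl_inner_def)
  qed
  then show ?thesis by (fastforce simp: collisions_def)
qed

subsection \<open>Counting collisions\<close>

abbreviation distance :: "nat \<Rightarrow> nat \<Rightarrow> real \<Rightarrow> real" where
  "distance j k t \<equiv> eucl_dist d (x j t) (x k t)"

definition collision_count :: "nat set \<Rightarrow> real \<Rightarrow> real \<Rightarrow> real" where
  "collision_count F s u = real (card (collisions d x F {s..u}))"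

lemma distance_lipschitz:
  assumes iso: "isolated F {a..b}" and st: "s \<in> {a..b}" "t \<in> {a..b}" and "j \<in> F" "k \<in> F"
  shows "distance j k s \<le> distance j k t + sqrt (energy F a) * \<bar>s - t\<bar>"
proof -
  have "distance j k s \<le> 1 * distance j k t +
      sqrt (\<Sum>p\<in>F \<times> F \<times> {..<d}. (pairdiff (\<lambda>k. x k s) p - 1 * pairdiff (\<lambda>k. x k t) p)\<^sup>2)"
    using assms isolated_finite[OF iso] by (intro eucl_dist_le_scaled) auto
  also have "sqrt (\<Sum>p\<in>F \<times> F \<times> {..<d}. (pairdiff (\<lambda>k. x k s) p - 1 * pairdiff (\<lambda>k. x k t) p)\<^sup>2)
      \<le> sqrt (energy F a * (s - t)\<^sup>2)"
    using isolated_lipschitz[OF iso st(2,1)] by simp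
  finally show ?thesis by (simp add: real_sqrt_mult)
qed

text \<open>Propagates a gap: balls far apart at an intermediate time are nearly as far apart at
  every \<open>t\<close> beyond it as seen from \<open>t0\<close>, with a loss that does not grow
  with \<open>t\<close>. The factors \<open>l\<close> and \<open>1 - l\<close> of the homothety
  estimate are bounded by 1.\<close>

lemma distance_rescaling:
  assumes iso: "isolated F {a..b}" and t: "t0 \<in> {a..b}" "t \<in> {a..b}" and "j \<in> F" "k \<in> F"
    and l: "0 \<le> l" "l \<le> 1"
  shows "distance j k (t0 + l * (t - t0)) \<le> distance j k t + sqrt (inertia F t0)"
proof -
  let ?s = "t0 + l * (t - t0)"
  let ?P = "F \<times> F \<times> {..<d}"
  have "?s = (1 - l) *\<^sub>R t0 + l *\<^sub>R t" by (simp add: algebra_simps)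
  then have s: "?s \<in> {a..b}"
    using convexD_alt[OF convex_real_interval(5) t l] by simp
  have "(\<Sum>p\<in>?P. (pairdiff (\<lambda>k. x k ?s) p - l * pairdiff (\<lambda>k. x k t) p)\<^sup>2) \<le> (1 - l)\<^sup>2 * inertia F t0"
    unfolding inertia_def
  proof (rule strongly_convex_norm_rescaling[OF l, where E = "energy F a"])
    show "(\<Sum>p\<in>?P. (pairdiff (\<lambda>k. x k t) p - pairdiff (\<lambda>k. x k ?s) p)\<^sup>2) \<le> energy F a * (t - ?s)\<^sup>2"
      by (rule isolated_lipschitz[OF iso s t(2)])
  qed (use inertia_strongly_convex[OF iso t l] in \<open>simp add: inertia_def\<close>)
  also have "\<dots> \<le> 1 * inertia F t0"
    using l by (intro mult_right_mono) (auto simp: inertia_def sum_nonneg power_le_one)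
  finally have "sqrt (\<Sum>p\<in>?P. (pairdiff (\<lambda>k. x k ?s) p - l * pairdiff (\<lambda>k. x k t) p)\<^sup>2) \<le> sqrt (inertia F t0)"
    by simp
  moreover have "distance j k ?s \<le> l * distance j k t +
      sqrt (\<Sum>p\<in>?P. (pairdiff (\<lambda>k. x k ?s) p - l * pairdiff (\<lambda>k. x k t) p)\<^sup>2)"
    using assms isolated_finite[OF iso] by (intro eucl_dist_le_scaled) auto
  moreover have "l * distance j k t \<le> 1 * distance j k t"
    using l by (intro mult_right_mono) (auto simp: eucl_dist_nonneg)
  ultimately show ?thesis by linarith
qed

text \<open>Strong convexity at the midpoint of \<open>t0\<close> and \<open>t\<close>, where the
  inertia is at least its minimum.\<close>

lemma inertia_growth:
  assumes iso: "isolated F {a..b}" and t: "t0 \<in> {a..b}" "t \<in> {a..b}"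
    and min: "\<And>s. s \<in> {a..b} \<Longrightarrow> inertia F t0 \<le> inertia F s"
  shows "inertia F t0 + energy F a * (t - t0)\<^sup>2 / 2 \<le> inertia F t"
proof -
  have "inertia F t0 \<le> inertia F (t0 + 1 / 2 * (t - t0))"
    using t by (intro min) (auto simp: field_simps)
  also have "\<dots> \<le> (1 - 1 / 2) * inertia F t0 + 1 / 2 * inertia F t
      - energy F a * (1 / 2) * (1 - 1 / 2) * (t - t0)\<^sup>2"
    by (rule inertia_strongly_convex[OF iso t]) auto
  finally show ?thesis by simp
qed

section \<open>Splitting a family into separated or connected parts\<close>

lemma inertia_eq_distances:
  "inertia F t = (\<Sum>j\<in>F. \<Sum>k\<in>F. (distance j k t)\<^sup>2)"
  by (simp add: inertia_def eucl_dist_squared sum.cartesian_product pairdiff_def case_prod_unfold)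

text \<open>If all distances were at most \<open>r / (2 * n)\<close>, the inertia would be at most
  \<open>r ^ 2 / 4\<close>. So some pair is farther apart; \<open>exists_gap\<close> for the
  distance from \<open>j0\<close> costs another factor \<open>card F \<le> n\<close>, and the
  triangle inequality turns the gap into a separation.\<close>

lemma exists_separated_split:
  assumes "F \<subseteq> {..<n}" and r: "0 < r" "r\<^sup>2 \<le> inertia F s"
  obtains A B where "A \<union> B = F" "A \<inter> B = {}" "A \<noteq> {}" "B \<noteq> {}"
    "\<And>j k. j \<in> A \<Longrightarrow> k \<in> B \<Longrightarrow> r / (2 * real n ^ 2) \<le> distance j k s"
proof -
  have fin: "finite F" using assms(1) finite_subset by blast
  have "F \<noteq> {}" using r by (auto simp: inertia_def)
  then have "0 < card F" "card F \<le> n"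
    using fin card_mono[OF _ assms(1)] by (auto simp: card_gt_0_iff)
  then have c: "0 < real (card F)" "real (card F) \<le> real n" "0 < real n" by auto
  have "\<exists>j\<in>F. \<exists>k\<in>F. r / (2 * real n) < distance j k s"
  proof (rule ccontr)
    assume "\<not> ?thesis"
    then have "(distance j k s)\<^sup>2 \<le> (r / (2 * real n))\<^sup>2" if "j \<in> F" "k \<in> F" for j k
      using that by (intro power_mono eucl_dist_nonneg) (auto simp: not_less)
    then have "inertia F s \<le> (\<Sum>j\<in>F. \<Sum>k\<in>F. (r / (2 * real n))\<^sup>2)"
      unfolding inertia_eq_distances by (intro sum_mono)
    also have "\<dots> = (real (card F) * (r / (2 * real n)))\<^sup>2"
      by (simp add: power2_eq_square)
    also have "\<dots> \<le> (real n * (r / (2 * real n)))\<^sup>2"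
      using c r by (intro power_mono mult_right_mono) auto
    also have "\<dots> = r\<^sup>2 / 4" using c by (simp add: power2_eq_square)
    finally show False using r zero_less_power[OF r(1), of 2] by linarith
  qed
  then obtain j0 k0 where jk0: "j0 \<in> F" "k0 \<in> F" "r / (2 * real n) < distance j0 k0 s" by blast
  have "distance j0 j0 s \<le> 0" "0 < r / (2 * real n)" using c r by simp_all
  then obtain A B where AB: "A \<union> B = F" "A \<inter> B = {}" "j0 \<in> A" "k0 \<in> B"
    and gap: "\<forall>a\<in>A. \<forall>b\<in>B. r / (2 * real n) / card F \<le> distance j0 b s - distance j0 a s"
    using exists_gap[where \<phi> = "\<lambda>j. distance j0 j s", OF fin jk0(1) _ jk0(2,3)] by blast
  show thesis
  proof
    show "A \<union> B = F" "A \<inter> B = {}" "A \<noteq> {}" "B \<noteq> {}" using AB by auto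
    fix a b assume ab: "a \<in> A" "b \<in> B"
    have "r / (2 * real n ^ 2) = r / (2 * real n) / real n"
      by (simp add: power2_eq_square)
    also have "\<dots> \<le> r / (2 * real n) / card F"
      using c r by (intro divide_left_mono) auto
    also have "\<dots> \<le> distance j0 b s - distance j0 a s" using gap ab by blast
    also have "\<dots> \<le> distance a b s"
      using eucl_dist_triangle[of d "x j0 s" "x b s" "x a s"] by linarith
    finally show "r / (2 * real n ^ 2) \<le> distance a b s" .
  qed
qed

lemma collision_count_subadditive:
  assumes "F \<subseteq> {..<n}" "s \<le> u" "u \<le> w"
  shows "collision_count F s w \<le> collision_count F s u + collision_count F u w"
proof -
  have "collisions d x F {s..w} \<subseteq> collisions d x F {s..u} \<union> collisions d x F {u..w}"
    using assms(2,3) by (auto simp: collisions_def) (metis linear)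
  then have "card (collisions d x F {s..w}) \<le> card (collisions d x F {s..u} \<union> collisions d x F {u..w})"
    using assms(1) by (intro card_mono) (auto simp: finite_collisions_Icc)
  also have "\<dots> \<le> card (collisions d x F {s..u}) + card (collisions d x F {u..w})"
    by (rule card_Un_le)
  finally show ?thesis by (simp add: collision_count_def)
qed

text \<open>A separation above \<open>2 + \<delta>\<close> at the reference time \<open>s\<close>
  stays above 2 on all of \<open>{u..w}\<close>. The two parts never collide with each other there
  and are smaller isolated families.\<close>

lemma split_collision_bound:
  assumes iso: "isolated F {a..b}" and "a \<le> u" "u \<le> w" "w \<le> b"
    and r: "0 < r" "r\<^sup>2 \<le> inertia F s"
    and near: "\<And>j k t. j \<in> F \<Longrightarrow> k \<in> F \<Longrightarrow> t \<in> {u..w} \<Longrightarrow> distance j k s \<le> distance j k t + \<delta>"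
    and gap: "2 + \<delta> < r / (2 * real n ^ 2)"
    and IH: "\<And>A. isolated A {u..w} \<Longrightarrow> card A < card F \<Longrightarrow> collision_count A u w \<le> X"
  shows "collision_count F u w \<le> 2 * X"
proof -
  have F: "F \<subseteq> {..<n}" "finite F"
    using iso isolated_finite[OF iso] by (auto simp: isolated_def)
  obtain A B where AB: "A \<union> B = F" "A \<inter> B = {}" "A \<noteq> {}" "B \<noteq> {}"
    and sep: "\<And>j k. j \<in> A \<Longrightarrow> k \<in> B \<Longrightarrow> r / (2 * real n ^ 2) \<le> distance j k s"
    using exists_separated_split[OF F(1) r] by metis
  have "2 < distance j k t" if "j \<in> A" "k \<in> B" "t \<in> {u..w}" for j k t
    using sep[OF that(1,2)] near[of j k t] gap that AB(1) by fastforce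
  then have none: "\<not> collide d x t j k" "\<not> collide d x t k j"
    if "j \<in> A" "k \<in> B" "t \<in> {u..w}" for j k t
    using that by (fastforce simp: collide_def eucl_dist_commute)+
  have iso': "isolated F {u..w}"
    using isolated_subset[OF iso, of "{u..w}"] assms(2-4) by auto
  have "isolated A {u..w}" "isolated B {u..w}"
    using iso' none AB(1) unfolding isolated_def by blast+
  moreover have "card A < card F" "card B < card F"
    using AB F(2) by (auto intro!: psubset_card_mono)
  ultimately have "collision_count A u w \<le> X" "collision_count B u w \<le> X"
    using IH by blast+
  moreover have "collisions d x F {u..w} \<subseteq> collisions d x A {u..w} \<union> collisions d x B {u..w}"
    using none AB(1) unfolding collisions_def by blast
  then have "card (collisions d x F {u..w}) \<le> card (collisions d x A {u..w} \<union> collisions d x B {u..w})"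
    using F AB(1) by (intro card_mono) (auto simp: finite_collisions_Icc)
  then have "collision_count F u w \<le> collision_count A u w + collision_count B u w"
    using card_Un_le[of "collisions d x A {u..w}" "collisions d x B {u..w}"]
    by (simp add: collision_count_def)
  ultimately show ?thesis by linarith
qed

text \<open>The graph is frozen at time \<open>s\<close> with the intermediate threshold
  \<open>2 + \<rho> / 2\<close>: its edges stay within \<open>2 + \<rho>\<close> on the whole
  interval, and every pair colliding there is an edge. Components are indexed by their members, so
  repetitions cost at most the factor \<open>n\<close>.\<close>

lemma connected_components_collision_bound:
  assumes F: "F \<subseteq> {..<n}"
    and M: "\<And>B. B \<subseteq> F \<Longrightarrow> rho_connected n d x \<rho> B {s..u} \<Longrightarrow> collision_count B s u \<le> M"
    and "0 \<le> M"
    and near: "\<And>j k t. j \<in> F \<Longrightarrow> k \<in> F \<Longrightarrow> t \<in> {s..u} \<Longrightarrow>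
      distance j k t \<le> distance j k s + \<rho> / 2 \<and> distance j k s \<le> distance j k t + \<rho> / 2"
  shows "collision_count F s u \<le> real n * M"
proof -
  have fin: "finite F" using F finite_subset by blast
  define r where "r = {(j, k) \<in> F \<times> F. distance j k s \<le> 2 + \<rho> / 2}"
  define C where "C j = {k \<in> F. (j, k) \<in> r\<^sup>*}" for j
  have "sym r" by (auto simp: r_def sym_def eucl_dist_commute)
  then have sym: "sym (r\<^sup>*)" by (rule sym_rtrancl)
  have "rho_connected n d x \<rho> (C j) {s..u}" for j
    unfolding rho_connected_def
  proof (intro ballI)
    fix t p q assume t: "t \<in> {s..u}" and "p \<in> C j" "q \<in> C j"
    then have "(p, q) \<in> r\<^sup>*"
      using sym by (auto simp: C_def dest: symD intro: rtrancl_trans)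
    \<comment> \<open>\<open>r\<close> contains loops, which \<open>proximity\<close> excludes;
      hence the reflexive closure.\<close>
    moreover have "r \<subseteq> (proximity n d x \<rho> t)\<^sup>="
      using near[OF _ _ t] F by (fastforce simp: r_def proximity_def)
    then have "r\<^sup>* \<subseteq> (proximity n d x \<rho> t)\<^sup>*"
      by (metis rtrancl_mono rtrancl_reflcl)
    ultimately show "(p, q) \<in> (proximity n d x \<rho> t)\<^sup>*" by blast
  qed
  then have "collision_count (C j) s u \<le> M" for j
    by (intro M) (auto simp: C_def)
  then have bound: "(\<Sum>j\<in>F. collision_count (C j) s u) \<le> real (card F) * M"
    by (intro sum_bounded_above)
  have "collisions d x F {s..u} \<subseteq> (\<Union>j\<in>F. collisions d x (C j) {s..u})"
  proof
    fix c assume "c \<in> collisions d x F {s..u}"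
    then obtain j k t where c: "c = ({j, k}, t)" and jk: "j \<in> F" "k \<in> F"
      and t: "t \<in> {s..u}" and col: "collide d x t j k"
      by (auto simp: collisions_def)
    have "(j, k) \<in> r"
      using near[OF jk t] jk col by (auto simp: r_def collide_def)
    then have "j \<in> C j" "k \<in> C j" using jk by (auto simp: C_def)
    then have "c \<in> collisions d x (C j) {s..u}"
      using c t col by (auto simp: collisions_def)
    then show "c \<in> (\<Union>j\<in>F. collisions d x (C j) {s..u})" using jk by blast
  qed
  moreover have "finite (collisions d x (C j) {s..u})" for j
    using F by (intro finite_collisions_Icc) (auto simp: C_def)
  ultimately have "card (collisions d x F {s..u}) \<le> card (\<Union>j\<in>F. collisions d x (C j) {s..u})"
    using fin by (intro card_mono) auto
  also have "\<dots> \<le> (\<Sum>j\<in>F. card (collisions d x (C j) {s..u}))"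
    by (rule card_UN_le[OF fin])
  finally have "collision_count F s u \<le> (\<Sum>j\<in>F. collision_count (C j) s u)"
    unfolding collision_count_def of_nat_sum[symmetric] of_nat_le_iff .
  also note bound
  also have "real (card F) * M \<le> real n * M"
    using card_mono[OF _ F] \<open>0 \<le> M\<close> by (intro mult_right_mono) auto
  finally show ?thesis .
qed

text \<open>
  Let \<open>I\<close> be minimal at \<open>t0\<close>, with value \<open>R\<^sup>2\<close>. Outside a window of length of order \<open>n\<^sup>2 R / sqrt E\<close>
  around \<open>t0\<close> the family splits once and for all on each side. Inside the window the family is spread
  out and splits on each of \<open>O(n ^ 4)\<close> short pieces if \<open>R > 8 n\<^sup>2\<close>; otherwise \<open>O(n ^ 4 / \<rho>)\<close>
  pieces suffice on which the distances change by at most \<open>\<rho> / 2\<close>.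
\<close>

lemma collision_count_recursion:
  assumes iso: "isolated F {a..b}" and "a \<le> b" and "0 < \<rho>" "0 \<le> M" "0 \<le> X"
    and M: "\<And>B t1 t2. B \<subseteq> {..<n} \<Longrightarrow> t1 \<le> t2 \<Longrightarrow> rho_connected n d x \<rho> B {t1..t2} \<Longrightarrow>
      collision_count B t1 t2 \<le> M"
    and IH: "\<And>A u w. isolated A {u..w} \<Longrightarrow> u \<le> w \<Longrightarrow> card A < card F \<Longrightarrow> collision_count A u w \<le> X"
  shows "collision_count F a b \<le>
    (352 * real n ^ 4 / \<rho> + 1) * (real n * M) + (256 * real n ^ 4 + 6) * X"
proof (cases "energy F a = 0")
  case True
  then have "collision_count F a b = 0"
    using no_collisions_if_energy_zero[OF iso] by (simp add: collision_count_def)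
  also have "0 \<le> (352 * real n ^ 4 / \<rho> + 1) * (real n * M) + (256 * real n ^ 4 + 6) * X"
    using assms by (intro add_nonneg_nonneg mult_nonneg_nonneg) auto
  finally show ?thesis .
next
  case False
  define v where "v = sqrt (energy F a)"
  have v: "0 < v" "energy F a = v\<^sup>2"
    using False energy_nonneg[of F a] by (auto simp: v_def)
  have F: "F \<subseteq> {..<n}" using iso by (simp add: isolated_def)
  have "F \<noteq> {}" using False by (auto simp: energy_def)
  then have n: "1 \<le> real n" using F by (cases n) auto
  have n2: "1 \<le> real n ^ 2" using n by (rule one_le_power)
  have n4: "real n ^ 4 = real n ^ 2 * real n ^ 2" by (simp flip: power_add)
  obtain t0 where t0: "t0 \<in> {a..b}" and min: "\<And>s. s \<in> {a..b} \<Longrightarrow> inertia F t0 \<le> inertia F s"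
    using continuous_attains_inf[OF compact_Icc _ continuous_inertia[OF F], of a b] \<open>a \<le> b\<close> by auto
  define R where "R = sqrt (inertia F t0)"
  have R: "0 \<le> R" "inertia F t0 = R\<^sup>2"
    by (auto simp: R_def inertia_def sum_nonneg)
  \<comment> \<open>By \<open>inertia_growth\<close> the inertia at distance \<open>\<tau>\<close>
    from \<open>t0\<close> is at least the square of \<open>4 * n ^ 2 * (R + 3)\<close>. The
    resulting split has gap \<open>2 * (R + 3)\<close>, more than the 2 of contact plus the loss
    \<open>R\<close> of the rescaling.\<close>
  define \<tau> where "\<tau> = 8 * real n ^ 2 * (R + 3) / v"
  have \<tau>: "0 < \<tau>" unfolding \<tau>_def using R n v by (intro divide_pos_pos mult_pos_pos) auto
  have far: "collision_count F u w \<le> 2 * X"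
    if s: "s \<in> {a..b}" "\<bar>s - t0\<bar> = \<tau>" and uw: "a \<le> u" "u \<le> w" "w \<le> b"
      and between: "\<And>t. t \<in> {u..w} \<Longrightarrow> (t0 \<le> s \<and> s \<le> t) \<or> (t \<le> s \<and> s \<le> t0)" for s u w
  proof (rule split_collision_bound[OF iso uw])
    show "0 < 4 * real n ^ 2 * (R + 3)" using R n by (intro mult_pos_pos) auto
    have "(s - t0)\<^sup>2 = \<tau>\<^sup>2" using s(2) by (metis power2_abs)
    then have "R\<^sup>2 + v\<^sup>2 * \<tau>\<^sup>2 / 2 \<le> inertia F s"
      using inertia_growth[OF iso t0 s(1) min] R v by simp
    then have "v\<^sup>2 * \<tau>\<^sup>2 / 2 \<le> inertia F s"
      using zero_le_power2[of R] by linarith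
    moreover have "v * \<tau> = 8 * real n ^ 2 * (R + 3)" using v by (simp add: \<tau>_def)
    then have "v\<^sup>2 * \<tau>\<^sup>2 = 4 * (4 * real n ^ 2 * (R + 3))\<^sup>2"
      unfolding power_mult_distrib[symmetric] by (simp add: power_mult_distrib)
    ultimately show "(4 * real n ^ 2 * (R + 3))\<^sup>2 \<le> inertia F s"
      using zero_le_power2[of "4 * real n ^ 2 * (R + 3)"] by linarith
    show "2 + R < 4 * real n ^ 2 * (R + 3) / (2 * real n ^ 2)" using n R by simp
    show "collision_count A u w \<le> X" if "isolated A {u..w}" "card A < card F" for A
      using IH that uw by blast
    fix j k t assume jk: "j \<in> F" "k \<in> F" and t: "t \<in> {u..w}"
    define l where "l = (s - t0) / (t - t0)"
    have "t \<noteq> t0" "0 \<le> l" "l \<le> 1"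
      using between[OF t] s(2) \<tau> by (auto simp: l_def divide_simps)
    moreover then have "t0 + l * (t - t0) = s" by (simp add: l_def)
    moreover have "t \<in> {a..b}" using t uw by auto
    ultimately show "distance j k s \<le> distance j k t + R"
      using distance_rescaling[OF iso t0 _ jk, of t l] by (simp add: R_def)
  qed
  define lo hi where "lo = max a (t0 - \<tau>)" and "hi = min b (t0 + \<tau>)"
  have lohi: "a \<le> lo" "lo \<le> t0" "t0 \<le> hi" "hi \<le> b" "hi - lo \<le> 2 * \<tau>"
    using t0 \<tau> by (auto simp: lo_def hi_def)
  have left: "collision_count F a b \<le> 2 * X + collision_count F lo b"
  proof (cases "a \<le> t0 - \<tau>")
    case True
    then have "lo = t0 - \<tau>" by (simp add: lo_def)
    then have "collision_count F a lo \<le> 2 * X"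
      using far[of lo a lo] lohi \<tau> t0 by auto
    then show ?thesis
      using collision_count_subadditive[OF F, of a lo b] lohi by linarith
  next
    case False
    then show ?thesis using \<open>0 \<le> X\<close> by (simp add: lo_def)
  qed
  have right: "collision_count F lo b \<le> collision_count F lo hi + 2 * X"
  proof (cases "t0 + \<tau> \<le> b")
    case True
    then have "hi = t0 + \<tau>" by (simp add: hi_def)
    then have "collision_count F hi b \<le> 2 * X"
      using far[of hi hi b] lohi \<tau> t0 by auto
    then show ?thesis
      using collision_count_subadditive[OF F, of lo hi b] lohi by linarith
  next
    case False
    then show ?thesis using \<open>0 \<le> X\<close> by (simp add: hi_def)
  qed
  have lip: "distance j k s \<le> distance j k t + v * \<delta>"
    if "j \<in> F" "k \<in> F" "s \<in> {lo..hi}" "t \<in> {lo..hi}" "\<bar>s - t\<bar> \<le> \<delta>" for j k s t \<delta>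
  proof -
    have "distance j k s \<le> distance j k t + v * \<bar>s - t\<bar>"
      using distance_lipschitz[OF iso _ _ that(1,2), of s t] that(3,4) lohi by (simp add: v_def)
    also have "v * \<bar>s - t\<bar> \<le> v * \<delta>" using v that(5) by (intro mult_left_mono) auto
    finally show ?thesis by simp
  qed
  have middle: "collision_count F lo hi \<le> (2 * \<tau> / \<delta> + 1) * Y"
    if piece: "\<And>s u. lo \<le> s \<Longrightarrow> s \<le> u \<Longrightarrow> u \<le> hi \<Longrightarrow> u - s \<le> \<delta> \<Longrightarrow> collision_count F s u \<le> Y"
      and "0 < \<delta>" "0 \<le> Y" for \<delta> Y
  proof -
    have "collision_count F lo hi \<le> ((hi - lo) / \<delta> + 1) * Y"
      using that lohi collision_count_subadditive[OF F] by (intro subadditive_le_by_pieces) auto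
    also have "\<dots> \<le> (2 * \<tau> / \<delta> + 1) * Y"
      using lohi that by (intro mult_right_mono add_right_mono divide_right_mono) auto
    finally show ?thesis .
  qed
  show ?thesis
  proof (cases "8 * real n ^ 2 < R")
    case True
    \<comment> \<open>On a piece the distances vary by at most
      \<open>v * \<delta> = R / (4 * n ^ 2)\<close>, half of the gap \<open>R / (2 * n ^ 2)\<close>;
      the other half exceeds 2 because \<open>R > 8 * n ^ 2\<close>.\<close>
    define \<delta> where "\<delta> = R / (4 * real n ^ 2 * v)"
    have "0 < R" and R_large: "3 \<le> R" using True n2 by linarith+
    have \<delta>: "0 < \<delta>" "v * \<delta> = R / (4 * real n ^ 2)"
      using \<open>0 < R\<close> n v by (auto simp: \<delta>_def intro!: divide_pos_pos mult_pos_pos)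
    have big: "2 < R / (4 * real n ^ 2)" using True n by (simp add: pos_less_divide_eq)
    have "2 * \<tau> / \<delta> = 64 * real n ^ 4 * ((R + 3) / R)"
    proof -
      have "2 * (8 * N * (R + 3) / v) / (R / (4 * N * v)) = 64 * (N * N) * ((R + 3) / R)" for N
        using v \<open>0 < R\<close> by (simp add: field_simps)
      then show ?thesis unfolding \<tau>_def \<delta>_def n4 .
    qed
    also have "\<dots> \<le> 64 * real n ^ 4 * 2"
      using R_large \<open>0 < R\<close> by (intro mult_left_mono) (auto simp: divide_le_eq)
    finally have count: "2 * \<tau> / \<delta> \<le> 128 * real n ^ 4" by simp
    have "collision_count F lo hi \<le> (2 * \<tau> / \<delta> + 1) * (2 * X)"
    proof (rule middle)
      fix s u assume su: "lo \<le> s" "s \<le> u" "u \<le> hi" "u - s \<le> \<delta>"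
      show "collision_count F s u \<le> 2 * X"
      proof (rule split_collision_bound[OF iso])
        show "a \<le> s" "s \<le> u" "u \<le> b" using su lohi by auto
        show "R\<^sup>2 \<le> inertia F s" using min[of s] su lohi R by auto
        show "2 + v * \<delta> < R / (2 * real n ^ 2)" using big unfolding \<delta> by simp
        show "distance j k s \<le> distance j k t + v * \<delta>" if "j \<in> F" "k \<in> F" "t \<in> {s..u}" for j k t
          using that su by (intro lip) auto
        show "collision_count A s u \<le> X" if "isolated A {s..u}" "card A < card F" for A
          using IH that su by blast
      qed fact
    qed (use \<delta> \<open>0 \<le> X\<close> in auto)
    also have "\<dots> \<le> (128 * real n ^ 4 + 1) * (2 * X)"
      using count \<open>0 \<le> X\<close> by (intro mult_right_mono) auto
    \<comment> \<open>The two outer parts contribute \<open>4 * X\<close>, and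
      \<open>2 * (128 * n ^ 4 + 1) + 4\<close> is the coefficient.\<close>
    finally have "collision_count F a b \<le> (256 * real n ^ 4 + 6) * X"
      using left right by (simp add: algebra_simps)
    moreover have "0 \<le> (352 * real n ^ 4 / \<rho> + 1) * (real n * M)"
      using assms by (intro mult_nonneg_nonneg add_nonneg_nonneg) auto
    ultimately show ?thesis by linarith
  next
    case False
    define \<delta> where "\<delta> = \<rho> / (2 * v)"
    have \<delta>: "0 < \<delta>" "v * \<delta> = \<rho> / 2" using v \<open>0 < \<rho>\<close> by (auto simp: \<delta>_def)
    have "2 * \<tau> / \<delta> = 32 * real n ^ 2 * (R + 3) / \<rho>"
      using v by (simp add: \<tau>_def \<delta>_def)
    \<comment> \<open>Here \<open>R \<le> 8 * n ^ 2\<close>, so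
      \<open>R + 3 \<le> 11 * n ^ 2\<close>.\<close>
    also have "\<dots> \<le> 32 * real n ^ 2 * (11 * real n ^ 2) / \<rho>"
      using False n2 \<open>0 < \<rho>\<close> by (intro divide_right_mono mult_left_mono) auto
    also have "32 * real n ^ 2 * (11 * real n ^ 2) = 352 * real n ^ 4"
      unfolding n4 by simp
    finally have count: "2 * \<tau> / \<delta> \<le> 352 * real n ^ 4 / \<rho>" .
    have "collision_count F lo hi \<le> (2 * \<tau> / \<delta> + 1) * (real n * M)"
    proof (rule middle)
      fix s u assume su: "lo \<le> s" "s \<le> u" "u \<le> hi" "u - s \<le> \<delta>"
      show "collision_count F s u \<le> real n * M"
      proof (rule connected_components_collision_bound[OF F _ \<open>0 \<le> M\<close>])
        show "collision_count B s u \<le> M" if "B \<subseteq> F" "rho_connected n d x \<rho> B {s..u}" for B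
          using M that F su by blast
        show "distance j k t \<le> distance j k s + \<rho> / 2 \<and> distance j k s \<le> distance j k t + \<rho> / 2"
          if "j \<in> F" "k \<in> F" "t \<in> {s..u}" for j k t
          unfolding \<delta>(2)[symmetric] using that su by (intro conjI lip) auto
      qed
    qed (use \<delta> \<open>0 \<le> M\<close> in auto)
    also have "\<dots> \<le> (352 * real n ^ 4 / \<rho> + 1) * (real n * M)"
      using count \<open>0 \<le> M\<close> by (intro mult_right_mono) auto
    finally have "collision_count F a b \<le> (352 * real n ^ 4 / \<rho> + 1) * (real n * M) + 4 * X"
      using left right by simp
    moreover have "4 * X \<le> (256 * real n ^ 4 + 6) * X"
      using \<open>0 \<le> X\<close> by (intro mult_right_mono) auto
    ultimately show ?thesis by linarith
  qed
qed

text \<open>Induction on the size of the family: \<open>H\<close> is the cost of the tight window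
  and \<open>Q - 1\<close> the coefficient of the smaller counts. As
  \<open>H \<le> H * Q ^ m\<close>, one level multiplies the bound by \<open>Q\<close>.
  \<open>M\<close> bounds all families of balls, so it passes unchanged to subfamilies.\<close>

lemma collision_count_bound:
  assumes "0 < \<rho>" "0 \<le> M"
    and M: "\<And>B t1 t2. B \<subseteq> {..<n} \<Longrightarrow> t1 \<le> t2 \<Longrightarrow> rho_connected n d x \<rho> B {t1..t2} \<Longrightarrow>
      collision_count B t1 t2 \<le> M"
    and "isolated F {a..b}" "a \<le> b"
  shows "collision_count F a b \<le>
    (352 * real n ^ 4 / \<rho> + 1) * (real n * M) * (256 * real n ^ 4 + 7) ^ card F"
  using assms(4,5)
proof (induction "card F" arbitrary: F a b rule: less_induct)
  case less
  define H where "H = (352 * real n ^ 4 / \<rho> + 1) * (real n * M)"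
  define Q where "Q = 256 * real n ^ 4 + 7"
  have H: "0 \<le> H" using assms(1,2) by (auto simp: H_def)
  have Q: "1 \<le> Q" by (simp add: Q_def)
  show ?case
  proof (cases "card F")
    case 0
    then have "F = {}" using isolated_finite[OF less.prems(1)] by simp
    then have "collisions d x F {a..b} = {}" by (simp add: collisions_def)
    then show ?thesis using H unfolding H_def[symmetric] by (simp add: collision_count_def 0)
  next
    case (Suc m)
    have "collision_count F a b \<le> H + (256 * real n ^ 4 + 6) * (H * Q ^ m)"
      unfolding H_def
    proof (rule collision_count_recursion[OF less.prems assms(1,2) _ M], unfold H_def[symmetric])
      show "0 \<le> H * Q ^ m" using H Q by simp
      fix A u w assume A: "isolated A {u..w}" "u \<le> w" "card A < card F"
      then have "collision_count A u w \<le> H * Q ^ card A"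
        using less.hyps by (simp add: H_def Q_def)
      also have "\<dots> \<le> H * Q ^ m"
        using A Suc H Q by (intro mult_left_mono power_increasing) auto
      finally show "collision_count A u w \<le> H * Q ^ m" .
    qed
    also have "\<dots> \<le> H * Q ^ m + (256 * real n ^ 4 + 6) * (H * Q ^ m)"
      using H Q mult_left_mono[of 1 "Q ^ m" H] by simp
    also have "256 * real n ^ 4 + 6 = Q - 1" by (simp add: Q_def)
    also have "H * Q ^ m + (Q - 1) * (H * Q ^ m) = H * Q ^ card F"
      by (simp add: Suc algebra_simps)
    finally show ?thesis unfolding H_def Q_def .
  qed
qed

text \<open>The bound does not depend on the time interval, and the family of all balls is trivially
  isolated. Every finite set of collisions lies in some \<open>{-T..T}\<close>, so finite subsets
  have uniformly bounded size, which yields finiteness too.\<close>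

lemma total_collision_bound:
  assumes "0 < \<rho>" "0 \<le> M"
    and M: "\<And>B t1 t2. B \<subseteq> {..<n} \<Longrightarrow> t1 \<le> t2 \<Longrightarrow> rho_connected n d x \<rho> B {t1..t2} \<Longrightarrow>
      collision_count B t1 t2 \<le> M"
  shows "finite (collisions d x {..<n} UNIV)"
    and "real (card (collisions d x {..<n} UNIV)) \<le>
      (352 * real n ^ 4 / \<rho> + 1) * (real n * M) * (256 * real n ^ 4 + 7) ^ n"
proof -
  define K where "K = (352 * real n ^ 4 / \<rho> + 1) * (real n * M) * (256 * real n ^ 4 + 7) ^ n"
  have K: "0 \<le> K" using assms(1,2) by (auto simp: K_def)
  have bound: "card G \<le> nat \<lfloor>K\<rfloor>" if G: "G \<subseteq> collisions d x {..<n} UNIV" "finite G" for G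
  proof -
    define T where "T = (\<Sum>c\<in>G. \<bar>snd c\<bar>)"
    have T: "\<bar>snd c\<bar> \<le> T" if "c \<in> G" for c
      unfolding T_def using G(2) that by (intro member_le_sum) auto
    have "G \<subseteq> collisions d x {..<n} {-T..T}"
    proof
      fix c assume "c \<in> G"
      then have "c \<in> collisions d x {..<n} UNIV" and "snd c \<in> {-T..T}"
        using G T[of c] by (auto simp: abs_le_iff)
      then show "c \<in> collisions d x {..<n} {-T..T}"
        unfolding collisions_def by force
    qed
    then have "card G \<le> card (collisions d x {..<n} {-T..T})"
      by (intro card_mono finite_collisions_Icc) auto
    moreover have "collision_count {..<n} (-T) T \<le> K"
      using collision_count_bound[OF assms, of "{..<n}" "-T" T]
      by (simp add: K_def isolated_def T_def sum_nonneg)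
    ultimately have "real (card G) \<le> K" by (simp add: collision_count_def)
    then show ?thesis by linarith
  qed
  show "finite (collisions d x {..<n} UNIV)"
    using finite_if_finite_subsets_card_bdd[OF bound] by blast
  have "card (collisions d x {..<n} UNIV) \<le> nat \<lfloor>K\<rfloor>"
    using finite_if_finite_subsets_card_bdd[OF bound] by blast
  then show "real (card (collisions d x {..<n} UNIV)) \<le>
      (352 * real n ^ 4 / \<rho> + 1) * (real n * M) * (256 * real n ^ 4 + 7) ^ n"
    using K unfolding K_def[symmetric] by linarith
qed

end

section \<open>Comparison of exponents and conclusion\<close>

lemma collision_bound_lt:
  fixes n :: nat and \<alpha> :: real
  assumes "1 < \<alpha>" "353 \<le> n" "34 powr (1 / (\<alpha> - 1)) \<le> real n"
  defines "L \<equiv> real n powr (1 / 3 * real n powr \<alpha>)"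
  shows "(352 * real n ^ 4 * L + 1) * (real n * L) * (256 * real n ^ 4 + 7) ^ n
    < real n powr (real n powr \<alpha>)"
proof -
  have n: "353 \<le> real n" using assms(2) by linarith
  \<comment> \<open>The number 34 gives \<open>n powr \<alpha> \<ge> 34 * n\<close>, a third of
    which exceeds the exponent \<open>6 + 5 * n\<close> of the polynomial factors.\<close>
  have "(34 powr (1 / (\<alpha> - 1))) powr (\<alpha> - 1) \<le> real n powr (\<alpha> - 1)"
    using assms by (intro powr_mono2) auto
  then have "34 \<le> real n powr (\<alpha> - 1)" using assms(1) by (simp add: powr_powr)
  then have "34 * real n \<le> real n powr (\<alpha> - 1) * real n" using n by (intro mult_right_mono) auto
  also have "\<dots> = real n powr \<alpha>" using n by (simp add: powr_diff)
  finally have exponent: "6 + 5 * real n + 2 / 3 * real n powr \<alpha> < real n powr \<alpha>"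
    using n by linarith
  have L: "1 \<le> L" unfolding L_def using n by (intro ge_one_powr_ge_zero) auto
  have n4: "1 \<le> real n ^ 4" using n by (intro one_le_power) auto
  have n5: "real n ^ 5 = real n * real n ^ 4" by (simp flip: power_Suc)
  \<comment> \<open>\<open>n \<ge> 353\<close> absorbs the coefficients \<open>352 + 1\<close> and
    \<open>256 + 7\<close> into one more power of \<open>n\<close>.\<close>
  have "353 * real n ^ 4 \<le> real n ^ 5" unfolding n5 using n by (intro mult_right_mono) auto
  then have Q: "256 * real n ^ 4 + 7 \<le> real n ^ 5" and c: "353 * real n ^ 4 \<le> real n ^ 5"
    using n4 by linarith+
  have "1 * 1 \<le> real n ^ 4 * L" using n4 L by (intro mult_mono) auto
  then have "352 * real n ^ 4 * L + 1 \<le> 353 * real n ^ 4 * L" by linarith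
  also have "\<dots> \<le> real n ^ 5 * L" using c L by (intro mult_right_mono) auto
  finally have "(352 * real n ^ 4 * L + 1) * (real n * L) * (256 * real n ^ 4 + 7) ^ n
      \<le> (real n ^ 5 * L) * (real n * L) * (real n ^ 5) ^ n"
    using Q L n by (intro mult_mono power_mono) auto
  also have "\<dots> = real n ^ (6 + 5 * n) * (L * L)"
  proof -
    have "real n ^ 6 = real n ^ 5 * real n" by (simp flip: power_Suc2)
    then show ?thesis by (simp add: power_add power_mult)
  qed
  also have "L * L = real n powr (2 / 3 * real n powr \<alpha>)"
    unfolding L_def by (simp flip: powr_add)
  also have "real n ^ (6 + 5 * n) = real n powr (6 + 5 * real n)"
    using n by (simp flip: powr_realpow)
  also have "real n powr (6 + 5 * real n) * real n powr (2 / 3 * real n powr \<alpha>) =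
      real n powr (6 + 5 * real n + 2 / 3 * real n powr \<alpha>)"
    by (simp add: powr_add)
  also have "\<dots> < real n powr (real n powr \<alpha>)"
    using exponent n by (intro powr_less_mono) auto
  finally show ?thesis .
qed

theorem corollary1p5:
  fixes \<alpha> :: real
  assumes "1 < \<alpha>" and "\<alpha> \<le> 2"
  shows "\<exists>n0::nat. \<forall>n\<ge>n0. \<forall>d\<ge>2. \<forall>x.
    hard_ball_evolution n d x \<longrightarrow>
    no_simultaneous_collisions n d x \<longrightarrow>
    infinite (collisions d x {..<n} UNIV) \<or>
      real (card (collisions d x {..<n} UNIV)) \<ge> real n powr (real n powr \<alpha>) \<longrightarrow>
    (\<exists>\<B> t1 t2. \<B> \<subseteq> {..<n} \<and> t1 \<le> t2 \<and>
       rho_connected n d x (real n powr (- (1/3) * real n powr \<alpha>)) \<B> {t1..t2} \<and>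
       real (card (collisions d x \<B> {t1..t2})) > real n powr ((1/3) * real n powr \<alpha>))"
proof (intro exI[of _ "max 353 (nat \<lceil>34 powr (1 / (\<alpha> - 1))\<rceil>)"] allI impI)
  fix n d :: nat and x :: motion
  assume n: "max 353 (nat \<lceil>34 powr (1 / (\<alpha> - 1))\<rceil>) \<le> n"
    and evolution: "hard_ball_evolution n d x" "no_simultaneous_collisions n d x"
    and many: "infinite (collisions d x {..<n} UNIV) \<or>
      real (card (collisions d x {..<n} UNIV)) \<ge> real n powr (real n powr \<alpha>)"
  interpret nonsimultaneous_evolution n d x
    using evolution by (simp add: nonsimultaneous_evolution_def nonsimultaneous_evolution_axioms_def)
  define L where "L = real n powr (1 / 3 * real n powr \<alpha>)"
  have n': "353 \<le> n" "34 powr (1 / (\<alpha> - 1)) \<le> real n" using n by (simp, linarith)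
  have L: "0 < L" "real n powr (- (1/3) * real n powr \<alpha>) = 1 / L"
    using n' by (auto simp: L_def powr_minus_divide)
  show "\<exists>\<B> t1 t2. \<B> \<subseteq> {..<n} \<and> t1 \<le> t2 \<and>
      rho_connected n d x (real n powr (- (1/3) * real n powr \<alpha>)) \<B> {t1..t2} \<and>
      real (card (collisions d x \<B> {t1..t2})) > real n powr ((1/3) * real n powr \<alpha>)"
  proof (rule ccontr)
    assume "\<not> ?thesis"
    \<comment> \<open>The negated conclusion is the hypothesis of
      \<open>total_collision_bound\<close> with \<open>M = L\<close> and
      \<open>\<rho> = 1 / L\<close>; \<open>M\<close> and \<open>1 / \<rho>\<close> then contribute
      only \<open>L ^ 2\<close>.\<close>
    then have few: "collision_count B t1 t2 \<le> L"
      if "B \<subseteq> {..<n}" "t1 \<le> t2" "rho_connected n d x (1 / L) B {t1..t2}" for B t1 t2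
      using that unfolding L(2) L_def[symmetric] collision_count_def by (meson not_less)
    note total = total_collision_bound[of "1 / L" L, OF _ _ few]
    have "finite (collisions d x {..<n} UNIV)"
      "real (card (collisions d x {..<n} UNIV)) \<le>
        (352 * real n ^ 4 * L + 1) * (real n * L) * (256 * real n ^ 4 + 7) ^ n"
      using total L(1) by simp_all
    with many collision_bound_lt[OF assms(1) n', folded L_def] show False
      by linarith
  qed
qed

end
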